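(* Let $\mathcal{M}$ be either $\{0,1\}$ with the discrete metric or $[0,1]$ with the usual metric. For $k\in\mathbb{N}_{\geq 2}$ and $R=P$ or $Q$, $$\Delta_{k+1}^G\not\ni\{\Xi_{k,R},\Omega_{k},\mathcal{M},\Lambda_k\}\in\Delta_{k+2}^A.$$ In other words, the problem $\{\Xi_{k,R},\Omega_{k},\mathcal{M},\Lambda_k\}$ can be solved via a height $k+1$ arithmetic tower, but it is impossible to do so with a height $k$ general tower.
   Context: **The combinatorial problems.** For $k\ge2$, $\Omega_k$ is the collection of all infinite arrays $a=\{a_{m_1,\ldots,m_k}\}_{m_1,\ldots,m_k\in\mathbb{N}}$ with entries in $\{0,1\}$, and $\Lambda_k$ is the set of component-wise evaluations $a\mapsto a_{m_1,\ldots,m_k}$. Define $$P(a,m_1,\ldots,m_{k-2})=\begin{cases}1,&\text{if }\exists i\ \forall j\ \exists n>j\text{ s.t. }a_{m_1,\ldots,m_{k-2},n,i}=1\\0,&\text{otherwise,}\end{cases}$$ $$Q(a,m_1,\ldots,m_{k-2})=\begin{cases}1,&\text{if }\forall^{\infty} i\ \forall j\ \exists n>j\text{ s.t. }a_{m_1,\ldots,m_{k-2},n,i}=1\\0,&\text{otherwise,}\end{cases}$$ where $\forall^\infty$ means "for all but a finite number of". For $R=P$ or $Q$ and $a\in\Omega_k$, $\Xi_{k,R}(a)\in\{0,1\}$ is the truth value of $$\begin{cases}\exists m_1\,\forall m_2\,\cdots\,\forall m_{k-2}\ R(a,m_1,\ldots,m_{k-2}),&\text{if }k\text{ is even}\\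 \forall m_1\,\exists m_2\,\cdots\,\forall m_{k-2}\ R(a,m_1,\ldots,m_{k-2}),&\text{if }k\text{ is odd,}\end{cases}$$ with quantifier types alternating and the last one being $\forall m_{k-2}$ (for $k=2$ there are no leading quantifiers, i.e. $\Xi_{2,R}(a)=R(a)$). **Towers.** A computational problem $\{\Xi,\Omega,\mathcal{M},\Lambda\}$ consists of a domain $\Omega$, a set $\Lambda$ of complex-valued functions on $\Omega$ separating points, a metric space $\mathcal{M}$ and a map $\Xi:\Omega\to\mathcal{M}$. A *general algorithm* is a map $\Gamma:\Omega\to\mathcal{M}$ such that for each $a\in\Omega$ there is a non-empty finite set $\Lambda_\Gamma(a)\subset\Lambda$ such that (i) $\Gamma(a)$ depends only on $\{h(a)\}_{h\in\Lambda_\Gamma(a)}$, and (ii) if $b\in\Omega$ satisfies $h(b)=h(a)$ for all $h\in\Lambda_\Gamma(a)$, then $\Lambda_\Gamma(b)=\Lambda_\Gamma(a)$ (hence $\Gamma(b)=\Gamma(a)$). A *tower of algorithms of height $m$* is a family of maps $\Gamma_{n_m},\Gamma_{n_m,n_{m-1}},\ldots,\Gamma_{n_m,\ldots,n_1}:\Omega\to\mathcal{M}$, $n_j\in\mathbb{N}$, where the $\Gamma_{n_m,\ldots,n_1}$ are general algorithms and for every $a\in\Omega$: $\Xi(a)=\lim_{n_m\to\infty}\Gamma_{n_m}(a)$ and $\Gamma_{n_m,\ldots,n_{j+1}}(a)=\lim_{n_j\to\infty}\Gamma_{n_m,\ldots,n_j}(a)$ for $j=m-1,\ldots,1$. It is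 of type $G$ (general) with no further restriction. It is of type $A$ (arithmetic) if moreover for each $a$ the map $(n_m,\ldots,n_1)\mapsto\Gamma_{n_m,\ldots,n_1}(a)$ is recursive, i.e. (as the evaluations here are rational) executable by a Turing machine with input $(n_m,\ldots,n_1)$ and an oracle for $\{h(a)\}_{h\in\Lambda}$. For $\alpha\in\{G,A\}$ and $m\geq 1$, $\Delta^\alpha_{m+1}$ is the class of problems having a type $\alpha$ tower of height at most $m$. "$\Delta\not\ni X\in\Delta'$" means $X\notin\Delta$ and $X\in\Delta'$. *)

theory Defs
  imports "HOL-Analysis.Analysis"
begin

section \<open>Computational problems\<close>

text \<open>
  The set \<open>\<Lambda>\<close> of evaluations is presented with names: \<open>evaluation p i\<close> is the evaluation with name \<open>i\<close>,
  and \<open>names p\<close> is the set of admissible names. The names, which are finite lists of natural numbers,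
  are what a Turing machine writes down in order to consult its oracle for \<open>{h(a)}\<^sub>h\<close>.
\<close>

record ('a, 'm) problem =
  dom_set :: "'a set"
  names :: "nat list set"
  evaluation :: "nat list \<Rightarrow> 'a \<Rightarrow> complex"
  target :: "'m metric"
  prob_map :: "'a \<Rightarrow> 'm"

definition evaluations :: "('a, 'm) problem \<Rightarrow> ('a \<Rightarrow> complex) set" where
  "evaluations p = evaluation p ` names p"

definition computational_problem :: "('a, 'm) problem \<Rightarrow> bool" where
  "computational_problem p \<longleftrightarrow>
     prob_map p \<in> dom_set p \<rightarrow> mspace (target p) \<and>
     (\<forall>a \<in> dom_set p. \<forall>b \<in> dom_set p. (\<forall>h \<in> evaluations p. h a = h b) \<longrightarrow> a = b)"

section \<open>General algorithms and towers\<close>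

definition general_algorithm :: "('a, 'm) problem \<Rightarrow> ('a \<Rightarrow> 'm) \<Rightarrow> bool" where
  "general_algorithm p \<Gamma> \<longleftrightarrow>
     \<Gamma> \<in> dom_set p \<rightarrow> mspace (target p) \<and>
     (\<exists>L. \<forall>a \<in> dom_set p.
        L a \<noteq> {} \<and> finite (L a) \<and> L a \<subseteq> evaluations p \<and>
        (\<forall>b \<in> dom_set p. (\<forall>h \<in> L a. h b = h a) \<longrightarrow> \<Gamma> b = \<Gamma> a \<and> L b = L a))"

text \<open>
  A tower of height \<open>m\<close> is a single function on index lists: \<open>\<Gamma> [n\<^sub>m, \<dots>, n\<^sub>j]\<close> is the map
  with the subscripts \<open>n\<^sub>m, \<dots>, n\<^sub>j\<close>. Only lists of length between 1 and \<open>m\<close> matter.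
\<close>

definition tower :: "('a, 'm) problem \<Rightarrow> nat \<Rightarrow> (nat list \<Rightarrow> 'a \<Rightarrow> 'm) \<Rightarrow> bool" where
  "tower p m \<Gamma> \<longleftrightarrow>
     (\<forall>ns. 1 \<le> length ns \<and> length ns \<le> m \<longrightarrow> \<Gamma> ns \<in> dom_set p \<rightarrow> mspace (target p)) \<and>
     (\<forall>ns. length ns = m \<longrightarrow> general_algorithm p (\<Gamma> ns)) \<and>
     (\<forall>a \<in> dom_set p.
        limitin (mtopology_of (target p)) (\<lambda>n. \<Gamma> [n] a) (prob_map p a) sequentially \<and>
        (\<forall>ns. 1 \<le> length ns \<and> length ns < m \<longrightarrow>
           limitin (mtopology_of (target p)) (\<lambda>n. \<Gamma> (ns @ [n]) a) (\<Gamma> ns a) sequentially))"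

section \<open>Oracle Turing machines\<close>

text \<open>
  Deterministic multitape machines over a fixed alphabet. A tape is a two-way infinite
  sequence of cells together with a head position. Tapes 0 to 3 are the input, query, answer and
  output tapes; all others are work tapes.
\<close>

datatype sym = Blank | Stroke | Sep | Minus

datatype dir = GoLeft | Stay | GoRight

type_synonym tape = "(int \<Rightarrow> sym) \<times> int"

type_synonym config = "nat \<times> tape list"

record machine =
  num_states :: nat
  num_tapes :: nat
  start_state :: nat
  halt_state :: nat
  query_state :: nat
  reply_state :: nat
  trans :: "nat \<Rightarrow> sym list \<Rightarrow> nat \<times> (sym \<times> dir) list"

definition wf_machine :: "machine \<Rightarrow> bool" where
  "wf_machine M \<longleftrightarrow>
     4 \<le> num_tapes M \<and>
     {start_state M, halt_state M, query_state M, reply_state M} \<subseteq> {..<num_states M} \<and>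
     halt_state M \<noteq> query_state M \<and>
     (\<forall>q < num_states M. \<forall>ss. length ss = num_tapes M \<longrightarrow>
        fst (trans M q ss) < num_states M \<and> length (snd (trans M q ss)) = num_tapes M)"

definition cells :: "sym list \<Rightarrow> int \<Rightarrow> sym" where
  "cells w i = (if 0 \<le> i \<and> i < int (length w) then w ! nat i else Blank)"

definition word_tape :: "sym list \<Rightarrow> tape" where
  "word_tape w = (cells w, 0)"

definition encode_nats :: "nat list \<Rightarrow> sym list" where
  "encode_nats ns = concat (map (\<lambda>n. replicate n Stroke @ [Sep]) ns)"

text \<open>Rationals are written in lowest terms: sign if negative, numerator in unary, separator, denominator in unary.\<close>

definition encode_rat :: "rat \<Rightarrow> sym list" where
  "encode_rat r = (case quotient_of r of (p, q) \<Rightarrow>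
     (if p < 0 then [Minus] else []) @ replicate (nat \<bar>p\<bar>) Stroke @ [Sep] @ replicate (nat q) Stroke)"

fun move :: "dir \<Rightarrow> int \<Rightarrow> int" where
  "move GoLeft h = h - 1"
| "move Stay h = h"
| "move GoRight h = h + 1"

fun act :: "sym \<times> dir \<Rightarrow> tape \<Rightarrow> tape" where
  "act (s, d) (f, h) = (f(h := s), move d h)"

fun scan :: "tape \<Rightarrow> sym" where
  "scan (f, h) = f h"

text \<open>
  The oracle is a single-valued relation: \<open>orc i r\<close> says that the evaluation named \<open>i\<close> has value \<open>r\<close>.
  In the query state the name on the query tape is erased and the value is put on the answer tape,
  both heads returning to cell 0. If the query tape carries no admissible name, the machine is stuck
  and does not halt.
\<close>

inductive step :: "machine \<Rightarrow> (nat list \<Rightarrow> rat \<Rightarrow> bool) \<Rightarrow> config \<Rightarrow> config \<Rightarrow> bool"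
  for M :: machine and orc :: "nat list \<Rightarrow> rat \<Rightarrow> bool" where
  ordinary: "\<lbrakk>q \<noteq> halt_state M; q \<noteq> query_state M; trans M q (map scan ts) = (q', acts)\<rbrakk>
     \<Longrightarrow> step M orc (q, ts) (q', map2 act acts ts)"
| query: "\<lbrakk>fst (ts ! 1) = cells (encode_nats i); orc i r\<rbrakk>
     \<Longrightarrow> step M orc (query_state M, ts)
           (reply_state M, ts[1 := word_tape [], 2 := word_tape (encode_rat r)])"

definition initial_config :: "machine \<Rightarrow> nat list \<Rightarrow> config" where
  "initial_config M ns =
     (start_state M, word_tape (encode_nats ns) # replicate (num_tapes M - 1) (word_tape []))"

definition computes :: "machine \<Rightarrow> (nat list \<Rightarrow> rat \<Rightarrow> bool) \<Rightarrow> nat list \<Rightarrow> rat \<Rightarrow> bool" where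
  "computes M orc ns r \<longleftrightarrow>
     (\<exists>ts. (step M orc)\<^sup>*\<^sup>* (initial_config M ns) (halt_state M, ts) \<and>
           fst (ts ! 3) = cells (encode_rat r))"

definition oracle_of :: "('a, 'm) problem \<Rightarrow> 'a \<Rightarrow> nat list \<Rightarrow> rat \<Rightarrow> bool" where
  "oracle_of p a i r \<longleftrightarrow> i \<in> names p \<and> evaluation p i a = of_rat r"

section \<open>The classes of general and arithmetic problems\<close>

text \<open>
  One machine serves all inputs \<open>a\<close>, which it accesses only through the oracle. The points of
  the target space are real numbers, output as rationals.
\<close>

definition arithmetic_tower :: "('a, real) problem \<Rightarrow> nat \<Rightarrow> (nat list \<Rightarrow> 'a \<Rightarrow> real) \<Rightarrow> bool" where
  "arithmetic_tower p m \<Gamma> \<longleftrightarrow>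
     tower p m \<Gamma> \<and>
     (\<exists>M. wf_machine M \<and>
        (\<forall>a \<in> dom_set p. \<forall>ns. length ns = m \<longrightarrow>
           (\<exists>r. computes M (oracle_of p a) ns r \<and> \<Gamma> ns a = of_rat r)))"

text \<open>\<open>Delta_G (m + 1)\<close> and \<open>Delta_A (m + 1)\<close> require a tower of height at most \<open>m\<close>, for \<open>m \<ge> 1\<close>.\<close>

definition Delta_G :: "nat \<Rightarrow> ('a, 'm) problem set" where
  "Delta_G d = {p. computational_problem p \<and>
     (\<exists>m. 1 \<le> m \<and> m + 1 \<le> d \<and> (\<exists>\<Gamma>. tower p m \<Gamma>))}"

definition Delta_A :: "nat \<Rightarrow> ('a, real) problem set" where
  "Delta_A d = {p. computational_problem p \<and>
     (\<exists>m. 1 \<le> m \<and> m + 1 \<le> d \<and> (\<exists>\<Gamma>. arithmetic_tower p m \<Gamma>))}"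

section \<open>The combinatorial problems\<close>

text \<open>
  The entry \<open>a\<^sub>m\<^sub>1\<^sub>,\<^sub>\<dots>\<^sub>,\<^sub>m\<^sub>k\<close> is \<open>a [m\<^sub>1, \<dots>, m\<^sub>k]\<close>. Arrays are extensional (undefined on lists of other
  lengths), so that equal entries mean equal arrays.
\<close>

type_synonym array = "nat list \<Rightarrow> nat"

definition Omega :: "nat \<Rightarrow> array set" where
  "Omega k = {ms. length ms = k} \<rightarrow>\<^sub>E {0, 1}"

definition P_rel :: "array \<Rightarrow> nat list \<Rightarrow> nat" where
  "P_rel a ms = (if \<exists>i. \<forall>j. \<exists>n>j. a (ms @ [n, i]) = 1 then 1 else 0)"

definition Q_rel :: "array \<Rightarrow> nat list \<Rightarrow> nat" where
  "Q_rel a ms = (if \<forall>\<^sub>\<infinity>i. \<forall>j. \<exists>n>j. a (ms @ [n, i]) = 1 then 1 else 0)"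

text \<open>
  \<open>alternate l \<phi>\<close> prefixes \<open>\<phi> [m\<^sub>1, \<dots>, m\<^sub>l]\<close> with \<open>l\<close> alternating quantifiers, the last of which is
  universal. Hence the first is existential exactly if \<open>l\<close> is even.
\<close>

primrec alternate :: "nat \<Rightarrow> (nat list \<Rightarrow> bool) \<Rightarrow> bool" where
  "alternate 0 \<phi> = \<phi> []"
| "alternate (Suc l) \<phi> =
     (if even (Suc l) then \<exists>m. alternate l (\<lambda>ms. \<phi> (m # ms))
      else \<forall>m. alternate l (\<lambda>ms. \<phi> (m # ms)))"

definition Xi :: "(array \<Rightarrow> nat list \<Rightarrow> nat) \<Rightarrow> nat \<Rightarrow> array \<Rightarrow> real" where
  "Xi R k a = of_bool (alternate (k - 2) (\<lambda>ms. R a ms = 1))"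

definition Xi_problem ::
  "(array \<Rightarrow> nat list \<Rightarrow> nat) \<Rightarrow> nat \<Rightarrow> real metric \<Rightarrow> (array, real) problem" where
  "Xi_problem R k \<M> =
     \<lparr>dom_set = Omega k, names = {ms. length ms = k}, evaluation = (\<lambda>ms a. of_nat (a ms)),
      target = \<M>, prob_map = Xi R k\<rparr>"

definition two_point_space :: "real metric" where
  "two_point_space = metric ({0, 1}, discrete_metric.dd)"

definition unit_interval_space :: "real metric" where
  "unit_interval_space = submetric euclidean_metric {0..1}"

end

theory Submission
  imports Defs
begin

text \<open>
  The predicates \<open>P\<close> and \<open>Q\<close> are \<open>\<Sigma>\<^sub>3\<close> questions about an array, and each of the \<open>k - 2\<close> quantifiers in
  front adds one level. So \<open>\<Xi>\<close> asks a question at level \<open>k + 1\<close> of the Borel hierarchy,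
  \<open>\<Sigma>\<close> for even \<open>k\<close> and \<open>\<Pi>\<close> for odd \<open>k\<close>, and the theorem says that a limit costs exactly
  as much as a quantifier.

  \<^bold>\<open>Height \<open>k\<close> is too low.\<close> A general algorithm is locally constant, and every limit raises the level by
  one. Hence a tower of height at most \<open>k\<close> puts both \<open>\<Xi> > 1/2\<close> and \<open>\<Xi> < 1/2\<close> into \<open>\<Sigma>\<close> of level \<open>k + 1\<close>
  (\<open>tower_baire\<close>); this covers both target spaces, as only real convergence is used. So the failure
  of \<open>\<Xi>\<close> can be written in the form in which \<open>\<Xi>\<close> itself is given: the same \<open>k - 2\<close> quantifiers, then
  ``for some \<open>i\<close> and infinitely many \<open>n\<close> the bit \<open>\<beta> ms i n\<close> is set'', where this bit can be read off
  from the entries all of whose indices are below \<open>n\<close> (\<open>borel_sigma_alternate_normal_form\<close>). Because of this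
  delay there is an array that consists of its own bits: its entry at \<open>ms, n, i\<close> is computed by
  recursion on \<open>n\<close> (\<open>exists_delayed_fixed_point\<close>). For that array \<open>\<Xi>\<close> holds if and only if it fails. The
  entry takes the disjunction of the bits over all \<open>i' \<le> i\<close>; this makes the columns increase with \<open>i\<close>, so
  that ``some column is infinite'' and ``almost all columns are infinite'' agree, and one construction
  serves \<open>P\<close> and \<open>Q\<close>.

  \<^bold>\<open>Height \<open>k + 1\<close> suffices.\<close> Every quantifier of the prefix is bounded by its own index of the
  tower. With \<open>x, y, z\<close> for the last three indices, the tower for \<open>P\<close> ends in
  \<open>\<exists>i\<le>x. \<exists>d\<le>z. a(ms, y + d, i) = 1\<close> and the one for \<open>Q\<close> in
  \<open>\<forall>e\<le>y. \<exists>d\<le>z. a(ms, y + d, x + e) = 1\<close>. When \<open>z\<close> tends to infinity, \<open>d\<close> becomes unbounded. When then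
  \<open>y\<close> does, ``some \<open>n \<ge> y\<close>'' becomes ``infinitely many \<open>n\<close>''; in the case of \<open>Q\<close> a finite column \<open>x + e\<close>
  is noticed once \<open>y\<close> has passed both \<open>e\<close> and the last 1 of that column. The limits through the bounded
  quantifiers further out are finite conjunctions or disjunctions of eventually constant sequences.

  \<^bold>\<open>The machine.\<close> All of these algorithms are searches through a box of index tuples. A small imperative
  language with a single query command is compiled to oracle machines, the states being the finitely many
  continuations of the program (\<open>compile_query_loop\<close>). The search is an odometer: head positions on
  unary tapes are the counters, and after each query the innermost counter that is still undecided moves
  on. The value that is handed from an inner quantifier to the next outer one is always the last
  answer of the oracle, so the machine stores nothing but its counters (\<open>search_sweep\<close>).
\<close>

section \<open>The two target spaces\<close>

lemma mspace_two_point_space: "mspace two_point_space = {0, 1}"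
  by (simp add: two_point_space_def Metric_space.mspace_metric metric_M_dd)

lemma mtopology_of_two_point_space: "mtopology_of two_point_space = discrete_topology {0, 1}"
  by (simp add: two_point_space_def mtopology_of_def Metric_space.mspace_metric
      Metric_space.mdist_metric metric_M_dd discrete_metric.mtopology_discrete_metric)

lemma mspace_unit_interval_space: "mspace unit_interval_space = {0..1}"
  by (simp add: unit_interval_space_def)

text \<open>
  The two target spaces enter the impossibility proof only through this: convergence in
  either of them is convergence of real numbers.
\<close>

lemma limitin_target_tendsto:
  assumes "\<M> = two_point_space \<or> \<M> = unit_interval_space"
    and "limitin (mtopology_of \<M>) f l sequentially"
  shows "f \<longlonglongrightarrow> l"
  using assms(1)
proof
  assume "\<M> = two_point_space"
  then have l: "l \<in> {0, 1}" and *: "\<And>U. openin (discrete_topology {0, 1}) U \<Longrightarrow> l \<in> U \<Longrightarrow> \<forall>\<^sub>F n in sequentially. f n \<in> U"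
    using assms(2) by (auto simp: limitin_def mtopology_of_two_point_space)
  have "\<forall>\<^sub>F n in sequentially. f n \<in> {l}"
    using l by (intro *) auto
  then show ?thesis
    by (auto intro!: tendsto_eventually elim: eventually_mono)
next
  assume "\<M> = unit_interval_space"
  then show ?thesis
    using assms(2) by (auto simp: unit_interval_space_def mtopology_of_submetric limitin_subtopology)
qed

section \<open>A Borel hierarchy on the space of arrays\<close>

definition agree :: "nat \<Rightarrow> nat \<Rightarrow> array \<Rightarrow> array \<Rightarrow> bool" where
  "agree k n a b \<longleftrightarrow> (\<forall>ms. length ms = k \<and> (\<forall>x\<in>set ms. x < n) \<longrightarrow> a ms = b ms)"

definition local_pred :: "nat \<Rightarrow> nat \<Rightarrow> (array \<Rightarrow> bool) \<Rightarrow> bool" where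
  "local_pred k n A \<longleftrightarrow> (\<forall>a\<in>Omega k. \<forall>b\<in>Omega k. agree k n a b \<longrightarrow> A a = A b)"

text \<open>
  The classes \<open>\<Sigma>\<^sub>s\<close> of subsets of \<open>Omega k\<close>, given by predicates of which only the values on \<open>Omega k\<close>
  matter. Level 0 consists of the sets that are decided by a finite block of entries, instead of the open sets;
  this makes level 0 closed under complements, so that the inclusion of each level in the next one
  starts with a trivial case.
\<close>

primrec borel_sigma :: "nat \<Rightarrow> nat \<Rightarrow> (array \<Rightarrow> bool) \<Rightarrow> bool" where
  "borel_sigma k 0 A \<longleftrightarrow> (\<exists>n. local_pred k n A)"
| "borel_sigma k (Suc s) A \<longleftrightarrow>
     (\<exists>B. (\<forall>m::nat. borel_sigma k s (\<lambda>a. \<not> B m a)) \<and> (\<forall>a\<in>Omega k. A a = (\<exists>m. B m a)))"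

lemma borel_sigma_SucE:
  assumes "borel_sigma k (Suc s) A"
  obtains B where "\<And>m::nat. borel_sigma k s (\<lambda>a. \<not> B m a)" "\<And>a. a \<in> Omega k \<Longrightarrow> A a = (\<exists>m. B m a)"
  using assms unfolding borel_sigma.simps by blast

lemma agree_mono: "agree k n a b \<Longrightarrow> n' \<le> n \<Longrightarrow> agree k n' a b"
  by (force simp: agree_def)

lemma agree_sym: "agree k n a b \<Longrightarrow> agree k n b a"
  by (simp add: agree_def)

lemma borel_sigma_Suc: "borel_sigma k s A \<Longrightarrow> borel_sigma k (Suc s) A"
proof (induction s arbitrary: A)
  case 0
  then obtain n where "local_pred k n A" by auto
  then have "local_pred k n (\<lambda>a. \<not> A a)" by (simp add: local_pred_def)
  then show ?case by (auto intro!: exI[of _ "\<lambda>_. A"])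
next
  case (Suc s)
  then obtain B where "\<And>m::nat. borel_sigma k s (\<lambda>a. \<not> B m a)" "\<forall>a\<in>Omega k. A a = (\<exists>m. B m a)"
    by auto
  with Suc.IH show ?case by (subst borel_sigma.simps) blast
qed

lemma borel_sigma_mono: "borel_sigma k s A \<Longrightarrow> s \<le> s' \<Longrightarrow> borel_sigma k s' A"
  by (rotate_tac, induction rule: dec_induct) (auto simp del: borel_sigma.simps intro: borel_sigma_Suc)

lemma borel_sigma_cong:
  "borel_sigma k s A \<Longrightarrow> (\<And>a. a \<in> Omega k \<Longrightarrow> A a = A' a) \<Longrightarrow> borel_sigma k s A'"
  by (cases s) (auto simp: local_pred_def)

lemma borel_sigma_Union:
  assumes "\<And>m::nat. borel_sigma k (Suc s) (A m)"
  shows "borel_sigma k (Suc s) (\<lambda>a. \<exists>m. A m a)"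
proof -
  have "\<forall>m. \<exists>B. (\<forall>j::nat. borel_sigma k s (\<lambda>a. \<not> B j a)) \<and> (\<forall>a\<in>Omega k. A m a = (\<exists>j. B j a))"
    using assms by simp
  then obtain B where B: "\<And>m j::nat. borel_sigma k s (\<lambda>a. \<not> B m j a)"
    "\<And>m a. a \<in> Omega k \<Longrightarrow> A m a = (\<exists>j. B m j a)"
    by metis
  define C where "C i = B (fst (prod_decode i)) (snd (prod_decode i))" for i
  have "(\<exists>m j. B m j a) = (\<exists>i. C i a)" for a
    unfolding C_def by (metis fst_conv snd_conv prod_encode_inverse)
  then show ?thesis
    using B by (auto simp: C_def intro!: exI[of _ C])
qed

lemma borel_sigma_not_Union:
  assumes "\<And>m::nat. borel_sigma k s (\<lambda>a. \<not> B m a)"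
  shows "borel_sigma k (Suc s) (\<lambda>a. \<exists>m. B m a)"
  using assms by auto

section \<open>Towers stay low in the hierarchy\<close>

text \<open>
  For \<open>s \<ge> 1\<close> these are the functions of Baire class \<open>s - 1\<close>, described by their superlevel and
  sublevel sets, which is all that the limit step needs.
\<close>

definition baire :: "nat \<Rightarrow> nat \<Rightarrow> (array \<Rightarrow> real) \<Rightarrow> bool" where
  "baire k s f \<longleftrightarrow> (\<forall>c. borel_sigma k s (\<lambda>a. f a > c) \<and> borel_sigma k s (\<lambda>a. f a < c))"

lemma baire_uminus: "baire k s f \<Longrightarrow> baire k s (\<lambda>a. - f a)"
  unfolding baire_def
proof (intro allI conjI)
  fix c
  assume f: "\<forall>c. borel_sigma k s (\<lambda>a. f a > c) \<and> borel_sigma k s (\<lambda>a. f a < c)"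
  show "borel_sigma k s (\<lambda>a. - f a > c)"
    by (rule borel_sigma_cong[OF conjunct2[OF spec[OF f, of "- c"]]]) auto
  show "borel_sigma k s (\<lambda>a. - f a < c)"
    by (rule borel_sigma_cong[OF conjunct1[OF spec[OF f, of "- c"]]]) auto
qed

text \<open>
  A limit exceeds \<open>c\<close> if and only if, for some \<open>q\<close> of the form \<open>c + 1 / (p + 1)\<close>, the sequence is eventually at least \<open>q\<close>.
  That a function is at least \<open>q\<close> on a whole tail is the complement of a set of the level below, and the
  choices of \<open>q\<close> and of the tail are countable unions.
\<close>

lemma borel_sigma_limit_greater:
  assumes "\<And>n. baire k (Suc s) (f n)"
    and lim: "\<And>a. a \<in> Omega k \<Longrightarrow> (\<lambda>n. f n a) \<longlonglongrightarrow> g a"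
  shows "borel_sigma k (Suc (Suc s)) (\<lambda>a. g a > c)"
proof -
  define q where "q p = c + 1 / real (Suc p)" for p
  have "borel_sigma k (Suc (Suc s)) (\<lambda>a. \<exists>p N. \<not> (\<exists>n. f (N + n) a < q p))"
  proof (rule borel_sigma_Union, rule borel_sigma_not_Union)
    show "borel_sigma k (Suc s) (\<lambda>a. \<not> \<not> (\<exists>n. f (N + n) a < q p))" for N p
      using assms(1) unfolding not_not baire_def by (intro borel_sigma_Union) blast
  qed
  moreover have "(\<exists>p N. \<not> (\<exists>n. f (N + n) a < q p)) \<longleftrightarrow> g a > c" if a: "a \<in> Omega k" for a
  proof
    assume "\<exists>p N. \<not> (\<exists>n. f (N + n) a < q p)"
    then obtain p N where "\<And>n. f (N + n) a \<ge> q p" by (force simp: not_less)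
    then have "\<And>n. n \<ge> N \<Longrightarrow> f n a \<ge> q p" by (metis le_add_diff_inverse)
    then have "g a \<ge> q p" by (intro LIMSEQ_le_const[OF lim[OF a]]) blast
    moreover have "q p > c" by (simp add: q_def)
    ultimately show "g a > c" by linarith
  next
    assume "g a > c"
    then obtain p where p: "1 / real (Suc p) < g a - c"
      by (metis diff_gt_0_iff_gt inverse_eq_divide reals_Archimedean)
    then have "q p < g a" by (simp add: q_def)
    then have "\<forall>\<^sub>F n in sequentially. f n a > q p" using lim[OF a] by (rule order_tendstoD(1)[rotated])
    then obtain N where "\<And>n. n \<ge> N \<Longrightarrow> f n a > q p" by (auto simp: eventually_sequentially)
    then have "\<not> (\<exists>n. f (N + n) a < q p)" by (metis le_add1 less_asym)
    then show "\<exists>p N. \<not> (\<exists>n. f (N + n) a < q p)" by blast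
  qed
  ultimately show ?thesis by (rule borel_sigma_cong)
qed

lemma baire_limit:
  assumes "\<And>n. baire k (Suc s) (f n)"
    and lim: "\<And>a. a \<in> Omega k \<Longrightarrow> (\<lambda>n. f n a) \<longlonglongrightarrow> g a"
  shows "baire k (Suc (Suc s)) g"
proof -
  have "borel_sigma k (Suc (Suc s)) (\<lambda>a. - g a > - c)" for c
    by (rule borel_sigma_limit_greater[where f = "\<lambda>n a. - f n a"])
      (use assms in \<open>auto intro: baire_uminus tendsto_minus simp del: borel_sigma.simps\<close>)
  then have "borel_sigma k (Suc (Suc s)) (\<lambda>a. g a < c)" for c
    by (rule borel_sigma_cong) auto
  then show ?thesis
    unfolding baire_def using borel_sigma_limit_greater[OF assms] by blast
qed

text \<open>
  An open set is the union over \<open>n\<close> of the arrays whose cylinder of stage \<open>n\<close> is contained in it.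
\<close>

lemma borel_sigma_1_open:
  assumes "\<And>a. a \<in> Omega k \<Longrightarrow> A a \<Longrightarrow> \<exists>n. \<forall>b\<in>Omega k. agree k n a b \<longrightarrow> A b"
  shows "borel_sigma k (Suc 0) A"
proof -
  define B where "B n a \<longleftrightarrow> (\<forall>b\<in>Omega k. agree k n a b \<longrightarrow> A b)" for n a
  have "agree k n b c \<Longrightarrow> B n b \<Longrightarrow> B n c" for n b c
    by (force simp: B_def agree_def)
  then have "local_pred k n (\<lambda>a. \<not> B n a)" for n
    unfolding local_pred_def by (metis agree_sym)
  moreover have "\<forall>a\<in>Omega k. A a = (\<exists>n. B n a)"
    using assms by (auto simp: B_def agree_def)
  ultimately show ?thesis unfolding borel_sigma.simps by blast
qed

lemma general_algorithm_locally_constant: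
  assumes "general_algorithm (Xi_problem R k \<M>) f" and a: "a \<in> Omega k"
  shows "\<exists>n. \<forall>b\<in>Omega k. agree k n a b \<longrightarrow> f b = f a"
proof -
  let ?p = "Xi_problem R k \<M>"
  obtain L where "\<forall>a\<in>dom_set ?p. L a \<noteq> {} \<and> finite (L a) \<and> L a \<subseteq> evaluations ?p \<and>
      (\<forall>b\<in>dom_set ?p. (\<forall>h\<in>L a. h b = h a) \<longrightarrow> f b = f a \<and> L b = L a)"
    using assms(1) unfolding general_algorithm_def by blast
  moreover have dom: "dom_set ?p = Omega k"
    by (simp add: Xi_problem_def)
  ultimately have L: "finite (L a)" "L a \<subseteq> evaluations ?p"
    "\<forall>b\<in>Omega k. (\<forall>h\<in>L a. h b = h a) \<longrightarrow> f b = f a"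
    using a unfolding dom by blast+
  define F where "F = L a"
  have F: "finite F" "F \<subseteq> evaluations (Xi_problem R k \<M>)"
    "\<forall>b\<in>Omega k. (\<forall>h\<in>F. h b = h a) \<longrightarrow> f b = f a"
    using L unfolding F_def by blast+
  from F(1,2) have "\<exists>n. \<forall>b\<in>Omega k. agree k n a b \<longrightarrow> (\<forall>h\<in>F. h b = h a)"
  proof (induction F)
    case (insert h F)
    then obtain n where n: "\<forall>b\<in>Omega k. agree k n a b \<longrightarrow> (\<forall>h\<in>F. h b = h a)" by auto
    obtain ms where ms: "length ms = k" "h = (\<lambda>a. of_nat (a ms))"
      using insert.prems by (auto simp: evaluations_def Xi_problem_def)
    obtain n' where n': "\<forall>x\<in>set ms. x < n'"
      using finite_nat_set_iff_bounded by blast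
    have "(\<forall>h\<in>insert h F. h b = h a)" if "b \<in> Omega k" "agree k (max n n') a b" for b
    proof -
      have "agree k n a b" "agree k n' a b"
        using that(2) agree_mono by (metis max.cobounded1, metis max.cobounded2)
      then show ?thesis
        using n n' ms that(1) by (auto simp: agree_def)
    qed
    then show ?case by blast
  qed auto
  with F(3) show ?thesis by blast
qed

lemma general_algorithm_baire:
  assumes "general_algorithm (Xi_problem R k \<M>) f"
  shows "baire k (Suc 0) f"
  unfolding baire_def
  by (intro allI conjI borel_sigma_1_open) (metis general_algorithm_locally_constant[OF assms])+

text \<open>
  Each of the \<open>m\<close> limits costs one level, starting from level 1 for the general algorithms.
\<close>

lemma tower_baire:
  assumes \<M>: "\<M> = two_point_space \<or> \<M> = unit_interval_space"
    and tower: "tower (Xi_problem R k \<M>) m \<Gamma>" and "m \<ge> 1"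
  shows "baire k (Suc m) (Xi R k)"
proof -
  have partial: "baire k (Suc d) (\<Gamma> ns)" if "length ns + d = m" "ns \<noteq> []" for d ns
    using that
  proof (induction d arbitrary: ns)
    case 0
    then show ?case
      using tower by (auto simp: tower_def intro!: general_algorithm_baire)
  next
    case (Suc d)
    show ?case
    proof (rule baire_limit[where f = "\<lambda>n. \<Gamma> (ns @ [n])"])
      show "baire k (Suc d) (\<Gamma> (ns @ [n]))" for n
        using Suc by auto
      have "1 \<le> length ns" "length ns < m"
        using Suc.prems by (auto simp: Suc_le_eq)
      then show "(\<lambda>n. \<Gamma> (ns @ [n]) a) \<longlonglongrightarrow> \<Gamma> ns a" if "a \<in> Omega k" for a
        using tower that limitin_target_tendsto[OF \<M>]
        by (auto simp: tower_def Xi_problem_def)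
    qed
  qed
  obtain d where d: "m = Suc d"
    using \<open>m \<ge> 1\<close> by (cases m) auto
  have "baire k (Suc (Suc d)) (Xi R k)"
  proof (rule baire_limit[where f = "\<lambda>n. \<Gamma> [n]"])
    show "baire k (Suc d) (\<Gamma> [n])" for n
      using d by (intro partial) auto
    show "(\<lambda>n. \<Gamma> [n] a) \<longlonglongrightarrow> Xi R k a" if "a \<in> Omega k" for a
      using tower that limitin_target_tendsto[OF \<M>] by (auto simp: tower_def Xi_problem_def)
  qed
  then show ?thesis by (simp add: d)
qed

section \<open>Normal forms with local bits\<close>

text \<open>
  A \<open>\<Pi>\<^sub>2\<close> set requires infinitely many conditions, each of which is settled at some finite stage if
  it holds. The bit of stage \<open>n\<close> is set when at \<open>n\<close>, and not before, an initial segment of the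
  conditions has been settled. These events are infinitely many if and only if all conditions hold.
\<close>

lemma pi2_infinitely_often:
  assumes "borel_sigma k 2 (\<lambda>a. \<not> A a)"
  shows "\<exists>\<beta>. (\<forall>n. local_pred k n (\<beta> n)) \<and> (\<forall>a\<in>Omega k. A a \<longleftrightarrow> (\<exists>\<^sub>\<infinity>n. \<beta> n a))"
proof -
  obtain B where B: "\<And>j::nat. borel_sigma k (Suc 0) (\<lambda>a. \<not> B j a)"
    and "\<And>a. a \<in> Omega k \<Longrightarrow> \<not> A a \<longleftrightarrow> (\<exists>j. B j a)"
    using assms[unfolded numeral_2_eq_2] by (rule borel_sigma_SucE) (rule that)
  then have AB: "\<And>a. a \<in> Omega k \<Longrightarrow> A a \<longleftrightarrow> (\<forall>j. \<not> B j a)"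
    by blast
  have "\<exists>C. (\<forall>s::nat. \<exists>n. local_pred k n (\<lambda>a. \<not> C s a)) \<and> (\<forall>a\<in>Omega k. (\<not> B j a) = (\<exists>s. C s a))" for j
    using borel_sigma_SucE[OF B[of j]] unfolding borel_sigma.simps(1) by metis
  then obtain C where C: "\<And>j s::nat. \<exists>n. local_pred k n (\<lambda>a. \<not> C j s a)"
    and BC: "\<And>j a. a \<in> Omega k \<Longrightarrow> \<not> B j a \<longleftrightarrow> (\<exists>s. C j s a)"
    by metis
  obtain \<nu> where "\<And>j s. local_pred k (\<nu> j s) (\<lambda>a. \<not> C j s a)"
    using C by metis
  then have \<nu>: "\<And>j s. local_pred k (\<nu> j s) (C j s)"
    by (simp add: local_pred_def)
  define D where "D j n a \<longleftrightarrow> j \<le> n \<and> (\<exists>s\<le>n. \<nu> j s \<le> n \<and> C j s a)" for j n a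
  have D_local: "local_pred k n (D j m)" if "m \<le> n" for j m n
    unfolding local_pred_def D_def using \<nu> that
    by (smt (verit) agree_mono le_trans local_pred_def)
  have D_mono: "D j n a \<Longrightarrow> n \<le> n' \<Longrightarrow> D j n' a" for j n n' a
    unfolding D_def by (meson le_trans)
  have D_iff: "(\<exists>n. D j n a) \<longleftrightarrow> \<not> B j a" if "a \<in> Omega k" for j a
  proof -
    have "D j (max j (max s (\<nu> j s))) a" if "C j s a" for s
      using that by (auto simp: D_def intro!: exI[of _ s])
    moreover have "\<exists>s. C j s a" if "D j n a" for n
      using that by (auto simp: D_def)
    ultimately show ?thesis
      using BC[OF that] by blast
  qed
  define E where "E t n a \<longleftrightarrow> (\<forall>j\<le>t. D j n a)" for t n a
  have E_mono: "E t n a \<Longrightarrow> n \<le> n' \<Longrightarrow> E t n' a" for t n n' a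
    unfolding E_def using D_mono by blast
  define \<beta> where "\<beta> n a \<longleftrightarrow> (\<exists>t. E t n a \<and> \<not> E t (n - 1) a)" for n a
  have "local_pred k n (\<beta> n)" for n
  proof -
    have "local_pred k n (E t m)" if "m \<le> n" for t m
      unfolding E_def using D_local[OF that] by (simp add: local_pred_def)
    then show ?thesis
      unfolding \<beta>_def by (simp add: local_pred_def)
  qed
  moreover have "A a \<longleftrightarrow> (\<exists>\<^sub>\<infinity>n. \<beta> n a)" if a: "a \<in> Omega k" for a
  proof
    assume "A a"
    then have ex: "\<exists>n. D j n a" for j
      using AB D_iff a by blast
    have E_ex: "\<exists>n. E t n a" for t
    proof -
      obtain n where n: "\<And>j. D j (n j) a" using ex by metis
      have "D j (Max (n ` {..t})) a" if "j \<le> t" for j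
        by (rule D_mono[OF n[of j]]) (use that in auto)
      then show ?thesis by (auto simp: E_def)
    qed
    show "\<exists>\<^sub>\<infinity>n. \<beta> n a"
      unfolding INFM_nat
    proof
      fix N
      \<comment> \<open>The first stage that settles the first \<open>N + 2\<close> conditions comes after \<open>N\<close>, because a
        condition is settled no earlier than its own index.\<close>
      define n where "n = (LEAST n. E (Suc N) n a)"
      have E: "E (Suc N) n a"
        using E_ex unfolding n_def by (metis LeastI_ex)
      then have "n > N"
        by (auto simp: E_def D_def)
      moreover have "\<not> E (Suc N) (n - 1) a"
        using not_less_Least[of "n - 1" "\<lambda>n. E (Suc N) n a"] \<open>n > N\<close> by (auto simp: n_def)
      ultimately show "\<exists>n>N. \<beta> n a"
        using E unfolding \<beta>_def by blast
    qed
  next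
    assume inf: "\<exists>\<^sub>\<infinity>n. \<beta> n a"
    show "A a"
    proof (rule ccontr)
      assume "\<not> A a"
      then obtain j where j: "\<And>n. \<not> D j n a"
        using AB D_iff a by blast
      \<comment> \<open>Only the first \<open>j\<close> thresholds are ever reached, and each of them fires once.\<close>
      have "{n. \<beta> n a} \<subseteq> (\<lambda>t. LEAST n. E t n a) ` {..<j}"
      proof
        fix n assume "n \<in> {n. \<beta> n a}"
        then obtain t where t: "E t n a" "\<not> E t (n - 1) a" by (auto simp: \<beta>_def)
        have "(LEAST n. E t n a) = n"
        proof (rule Least_equality[of "\<lambda>n. E t n a", OF t(1)])
          fix y assume "E t y a"
          show "n \<le> y"
          proof (rule ccontr)
            assume "\<not> n \<le> y"
            then have "E t (n - 1) a" by (intro E_mono[OF \<open>E t y a\<close>]) auto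
            with t show False by simp
          qed
        qed
        moreover have "t < j"
          using t j by (meson E_def not_le)
        ultimately show "n \<in> (\<lambda>t. LEAST n. E t n a) ` {..<j}" by force
      qed
      then have "finite {n. \<beta> n a}"
        using finite_surj by blast
      with inf show False by (simp add: INFM_iff_infinite)
    qed
  qed
  ultimately show ?thesis by blast
qed

lemma sigma3_infinitely_often:
  assumes "borel_sigma k 3 A"
  shows "\<exists>\<beta>. (\<forall>i n. local_pred k n (\<beta> i n)) \<and> (\<forall>a\<in>Omega k. A a \<longleftrightarrow> (\<exists>i::nat. \<exists>\<^sub>\<infinity>n. \<beta> i n a))"
proof -
  have three: "3 = Suc 2" by simp
  obtain B where B: "\<And>i::nat. borel_sigma k 2 (\<lambda>a. \<not> B i a)" "\<And>a. a \<in> Omega k \<Longrightarrow> A a = (\<exists>i. B i a)"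
    using assms[unfolded three] by (rule borel_sigma_SucE) (rule that)
  obtain \<beta> where "\<And>i n. local_pred k n (\<beta> i n)" "\<And>i a. a \<in> Omega k \<Longrightarrow> B i a \<longleftrightarrow> (\<exists>\<^sub>\<infinity>n. \<beta> i n a)"
    using pi2_infinitely_often[OF B(1)] by metis
  with B(2) show ?thesis by blast
qed

text \<open>
  Peeling off one union or intersection per quantifier leads down to \<open>\<Sigma>\<^sub>3\<close>. The parity of \<open>l\<close> decides
  whether the outermost quantifier is existential, hence whether \<open>A\<close> or its complement is \<open>\<Sigma>\<close>.
\<close>

lemma borel_sigma_alternate_normal_form:
  assumes "if even l then borel_sigma k (l + 3) A else borel_sigma k (l + 3) (\<lambda>a. \<not> A a)"
  shows "\<exists>\<beta>. (\<forall>ms i n. local_pred k n (\<beta> ms i n)) \<and>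
           (\<forall>a\<in>Omega k. A a \<longleftrightarrow> alternate l (\<lambda>ms. \<exists>i::nat. \<exists>\<^sub>\<infinity>n. \<beta> ms i n a))"
  using assms
proof (induction l arbitrary: A)
  case 0
  then obtain \<beta> where "\<And>(i::nat) n. local_pred k n (\<beta> i n)" "\<And>a. a \<in> Omega k \<Longrightarrow> A a \<longleftrightarrow> (\<exists>i. \<exists>\<^sub>\<infinity>n. \<beta> i n a)"
    using sigma3_infinitely_often by (metis add_0 even_zero)
  then show ?case by (intro exI[of _ "\<lambda>_. \<beta>"]) auto
next
  case (Suc l)
  define N where "N A = (if even (Suc l) then A else (\<lambda>a. \<not> A a))" for A :: "array \<Rightarrow> bool"
  have "borel_sigma k (Suc (l + 3)) (N A)"
    using Suc.prems by (auto simp: N_def simp del: borel_sigma.simps)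
  then obtain B where B: "\<And>m::nat. borel_sigma k (l + 3) (\<lambda>a. \<not> B m a)"
    "\<And>a. a \<in> Omega k \<Longrightarrow> N A a = (\<exists>m. B m a)"
    by (rule borel_sigma_SucE) (rule that)
  have "if even l then borel_sigma k (l + 3) (N (B m)) else borel_sigma k (l + 3) (\<lambda>a. \<not> N (B m) a)" for m
    using B(1) by (auto simp: N_def simp del: borel_sigma.simps)
  then have "\<forall>m. \<exists>\<beta>. (\<forall>ms i n. local_pred k n (\<beta> ms i n)) \<and>
      (\<forall>a\<in>Omega k. N (B m) a \<longleftrightarrow> alternate l (\<lambda>ms. \<exists>i::nat. \<exists>\<^sub>\<infinity>n. \<beta> ms i n a))"
    using Suc.IH by blast
  then have "\<exists>\<beta>. \<forall>m. (\<forall>ms i n. local_pred k n (\<beta> m ms i n)) \<and>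
      (\<forall>a\<in>Omega k. N (B m) a \<longleftrightarrow> alternate l (\<lambda>ms. \<exists>i::nat. \<exists>\<^sub>\<infinity>n. \<beta> m ms i n a))"
    by (rule choice)
  then obtain \<beta> where \<beta>: "\<And>m ms (i::nat) n. local_pred k n (\<beta> m ms i n)"
    "\<And>m a. a \<in> Omega k \<Longrightarrow> N (B m) a \<longleftrightarrow> alternate l (\<lambda>ms. \<exists>i. \<exists>\<^sub>\<infinity>n. \<beta> m ms i n a)"
    by blast
  define \<gamma> where "\<gamma> ms = \<beta> (hd ms) (tl ms)" for ms
  have "A a \<longleftrightarrow> alternate (Suc l) (\<lambda>ms. \<exists>i. \<exists>\<^sub>\<infinity>n. \<gamma> ms i n a)" if "a \<in> Omega k" for a
    using \<beta>(2)[OF that] B(2)[OF that] by (cases "even l") (simp_all add: \<gamma>_def N_def, blast)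
  then show ?case
    using \<beta>(1) by (intro exI[of _ \<gamma>]) (simp add: \<gamma>_def del: alternate.simps)
qed

section \<open>Arrays that refute a low description\<close>

text \<open>
  The map \<open>F\<close> that writes the bits of \<open>a\<close> into a new array is a contraction: an entry with
  coordinate \<open>p\<close> equal to \<open>n\<close> looks only at entries whose coordinate \<open>p\<close> is smaller than \<open>n\<close>. Hence the
  iterates of \<open>F\<close> stabilise at each entry, and the limit is a fixed point.
\<close>

lemma exists_delayed_fixed_point:
  assumes loc: "\<And>ms. length ms = k \<Longrightarrow> local_pred k (ms ! p) (\<beta> ms)" and "p < k"
  shows "\<exists>a\<in>Omega k. \<forall>ms. length ms = k \<longrightarrow> a ms = of_bool (\<beta> ms a)"
proof -
  define F :: "array \<Rightarrow> array" where
    "F a = (\<lambda>ms. if length ms = k then of_bool (\<beta> ms a) else undefined)" for a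
  define x where "x n = (F ^^ n) (F undefined)" for n
  have F_Omega: "F a \<in> Omega k" for a
    by (auto simp: F_def Omega_def PiE_iff extensional_def)
  have x_Suc: "x (Suc n) = F (x n)" for n
    by (simp add: x_def)
  have x_Omega: "x n \<in> Omega k" for n
    by (cases n) (auto simp: x_def F_Omega)
  have stable: "x (Suc n) ms = x n ms" if "length ms = k" "ms ! p < n" for n ms
    using that
  proof (induction n arbitrary: ms)
    case (Suc n)
    have "x (Suc n) ms' = x n ms'" if "length ms' = k" "\<forall>y\<in>set ms'. y < ms ! p" for ms'
    proof -
      have "ms' ! p < ms ! p" using that \<open>p < k\<close> by simp
      then show ?thesis using Suc.IH[OF that(1)] Suc.prems(2) by linarith
    qed
    then have "agree k (ms ! p) (x (Suc n)) (x n)"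
      unfolding agree_def by blast
    then have "\<beta> ms (x (Suc n)) = \<beta> ms (x n)"
      using loc[OF Suc.prems(1)] x_Omega unfolding local_pred_def by blast
    then have "F (x (Suc n)) ms = F (x n) ms"
      by (simp add: F_def)
    then show ?case by (simp only: x_Suc)
  qed auto
  have stable': "x n ms = x (Suc (ms ! p)) ms" if "length ms = k" "ms ! p < n" for n ms
    using that(2)[folded Suc_le_eq]
    by (induction n rule: dec_induct) (use stable that(1) in auto)
  define a where "a = (\<lambda>ms. if length ms = k then x (Suc (ms ! p)) ms else undefined)"
  have a_Omega: "a \<in> Omega k"
    using x_Omega by (auto simp: a_def Omega_def PiE_iff extensional_def)
  have "a ms = of_bool (\<beta> ms a)" if ms: "length ms = k" for ms
  proof -
    have "x (ms ! p) ms' = a ms'" if "length ms' = k" "\<forall>y\<in>set ms'. y < ms ! p" for ms'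
    proof -
      have "ms' ! p < ms ! p" using that \<open>p < k\<close> by simp
      then show ?thesis using stable'[OF that(1), of "ms ! p"] that(1) by (simp add: a_def)
    qed
    then have "agree k (ms ! p) (x (ms ! p)) a"
      unfolding agree_def by blast
    then have "\<beta> ms (x (ms ! p)) = \<beta> ms a"
      using loc[OF ms] x_Omega a_Omega unfolding local_pred_def by blast
    moreover have "a ms = F (x (ms ! p)) ms"
      using ms by (simp add: a_def x_Suc)
    ultimately show ?thesis
      using ms by (simp add: F_def)
  qed
  then show ?thesis
    by (intro bexI[OF _ a_Omega] allI impI)
qed

lemma alternate_cong:
  "(\<And>ms. length ms = l \<Longrightarrow> \<phi> ms = \<psi> ms) \<Longrightarrow> alternate l \<phi> = alternate l \<psi>"
proof (induction l arbitrary: \<phi> \<psi>)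
  case (Suc l)
  have "alternate l (\<lambda>ms. \<phi> (m # ms)) = alternate l (\<lambda>ms. \<psi> (m # ms))" for m
    by (rule Suc.IH) (simp add: Suc.prems)
  then show ?case by simp
qed auto

text \<open>
  Accumulating the columns identifies the questions behind \<open>P\<close> and \<open>Q\<close>: a finite union of columns is
  infinite if and only if one of the columns is, so infinity persists from the first infinite column on.
\<close>

lemma exists_INFM_accumulate:
  fixes \<beta> :: "nat \<Rightarrow> nat \<Rightarrow> bool"
  shows "(\<exists>i. \<exists>\<^sub>\<infinity>n. \<exists>i'\<le>i. \<beta> i' n) \<longleftrightarrow> (\<exists>i. \<exists>\<^sub>\<infinity>n. \<beta> i n)"
    and "(\<forall>\<^sub>\<infinity>i. \<exists>\<^sub>\<infinity>n. \<exists>i'\<le>i. \<beta> i' n) \<longleftrightarrow> (\<exists>i. \<exists>\<^sub>\<infinity>n. \<beta> i n)"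
proof -
  have finite_pigeonhole: "(\<exists>\<^sub>\<infinity>n. \<exists>i'\<le>i. \<beta> i' n) \<longleftrightarrow> (\<exists>i'\<le>i. \<exists>\<^sub>\<infinity>n. \<beta> i' n)" for i
  proof -
    have "{n. \<exists>i'\<le>i. \<beta> i' n} = (\<Union>i'\<le>i. {n. \<beta> i' n})" by auto
    then show ?thesis by (auto simp: INFM_iff_infinite)
  qed
  show "(\<exists>i. \<exists>\<^sub>\<infinity>n. \<exists>i'\<le>i. \<beta> i' n) \<longleftrightarrow> (\<exists>i. \<exists>\<^sub>\<infinity>n. \<beta> i n)"
    unfolding finite_pigeonhole by blast
  show "(\<forall>\<^sub>\<infinity>i. \<exists>\<^sub>\<infinity>n. \<exists>i'\<le>i. \<beta> i' n) \<longleftrightarrow> (\<exists>i. \<exists>\<^sub>\<infinity>n. \<beta> i n)"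
    unfolding finite_pigeonhole MOST_nat_le by (meson le_trans le_refl)
qed

text \<open>
  In the entry at \<open>ms @ [n, i]\<close> the coordinate that carries the delay is the last but one, \<open>n\<close>; this
  is the stage whose bits are entered there.
\<close>

lemma exists_array_matching_normal_form:
  assumes loc: "\<And>ms (i::nat) n. local_pred k n (\<beta> ms i n)" and "k \<ge> 2"
    and R: "R = P_rel \<or> R = Q_rel"
  shows "\<exists>a\<in>Omega k. Xi R k a = of_bool (alternate (k - 2) (\<lambda>ms. \<exists>i. \<exists>\<^sub>\<infinity>n. \<beta> ms i n a))"
proof -
  define \<gamma> where "\<gamma> ms a \<longleftrightarrow> (\<exists>i\<le>ms ! (k - 1). \<beta> (take (k - 2) ms) i (ms ! (k - 2)) a)" for ms a
  have "local_pred k (ms ! (k - 2)) (\<gamma> ms)" for ms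
    unfolding \<gamma>_def using loc by (simp add: local_pred_def)
  then obtain a where a: "a \<in> Omega k" "\<And>ms. length ms = k \<Longrightarrow> a ms = of_bool (\<gamma> ms a)"
    using exists_delayed_fixed_point[of k "k - 2" \<gamma>] \<open>k \<ge> 2\<close> by auto
  have "(R a ms = 1) \<longleftrightarrow> (\<exists>i. \<exists>\<^sub>\<infinity>n. \<beta> ms i n a)" if ms: "length ms = k - 2" for ms
  proof -
    have "a (ms @ [n, i]) = 1 \<longleftrightarrow> (\<exists>i'\<le>i. \<beta> ms i' n a)" for n i
      using ms \<open>k \<ge> 2\<close> by (subst a) (auto simp: \<gamma>_def nth_append Suc_diff_Suc)
    then have "P_rel a ms = 1 \<longleftrightarrow> (\<exists>i. \<exists>\<^sub>\<infinity>n. \<exists>i'\<le>i. \<beta> ms i' n a)"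
      and "Q_rel a ms = 1 \<longleftrightarrow> (\<forall>\<^sub>\<infinity>i. \<exists>\<^sub>\<infinity>n. \<exists>i'\<le>i. \<beta> ms i' n a)"
      by (simp_all add: P_rel_def Q_rel_def INFM_nat)
    then show ?thesis
      using R exists_INFM_accumulate[of "\<lambda>i n. \<beta> ms i n a"] by auto
  qed
  then have "alternate (k - 2) (\<lambda>ms. R a ms = 1) = alternate (k - 2) (\<lambda>ms. \<exists>i. \<exists>\<^sub>\<infinity>n. \<beta> ms i n a)"
    by (rule alternate_cong)
  then show ?thesis
    unfolding Xi_def by (intro bexI[OF _ a(1)]) (simp only:)
qed

text \<open>
  The fixed point for a description of \<open>\<Xi> = 0\<close> has \<open>\<Xi> = 1\<close> if and only if it has \<open>\<Xi> = 0\<close>.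
\<close>

theorem Xi_problem_not_Delta_G:
  assumes \<M>: "\<M> = two_point_space \<or> \<M> = unit_interval_space"
    and "k \<ge> 2" and R: "R = P_rel \<or> R = Q_rel"
  shows "Xi_problem R k \<M> \<notin> Delta_G (k + 1)"
proof
  assume "Xi_problem R k \<M> \<in> Delta_G (k + 1)"
  then obtain m \<Gamma> where "1 \<le> m" "m \<le> k" "tower (Xi_problem R k \<M>) m \<Gamma>"
    by (auto simp: Delta_G_def)
  then have "baire k (Suc m) (Xi R k)"
    using tower_baire[OF \<M>] by blast
  then have *: "borel_sigma k (Suc k) (\<lambda>a. Xi R k a > 1/2)" "borel_sigma k (Suc k) (\<lambda>a. Xi R k a < 1/2)"
    using borel_sigma_mono[of k "Suc m" _ "Suc k"] \<open>m \<le> k\<close> unfolding baire_def by blast+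
  have "borel_sigma k (Suc k) (\<lambda>a. \<not> Xi R k a = 0)"
    by (rule borel_sigma_cong[OF *(1)]) (auto simp: Xi_def)
  moreover have "borel_sigma k (Suc k) (\<lambda>a. Xi R k a = 0)"
    by (rule borel_sigma_cong[OF *(2)]) (auto simp: Xi_def)
  moreover have "k - 2 + 3 = Suc k"
    using \<open>k \<ge> 2\<close> by simp
  ultimately have "if even (k - 2) then borel_sigma k (k - 2 + 3) (\<lambda>a. Xi R k a = 0)
      else borel_sigma k (k - 2 + 3) (\<lambda>a. \<not> Xi R k a = 0)"
    by presburger
  from borel_sigma_alternate_normal_form[OF this] obtain \<beta> where \<beta>: "\<And>ms (i::nat) n. local_pred k n (\<beta> ms i n)"
    "\<And>a. a \<in> Omega k \<Longrightarrow> Xi R k a = 0 \<longleftrightarrow> alternate (k - 2) (\<lambda>ms. \<exists>i. \<exists>\<^sub>\<infinity>n. \<beta> ms i n a)"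
    by blast
  with exists_array_matching_normal_form[of k \<beta>, OF _ \<open>k \<ge> 2\<close> R] show False
    by force
qed

section \<open>A small programming language for oracle machines\<close>

type_synonym mem = "nat \<Rightarrow> tape"

text \<open>
  Programs act on the tapes one at a time: \<open>Put t s d\<close> writes \<open>s\<close> on tape \<open>t\<close> and moves its head,
  \<open>Mv t d\<close> only moves it. Tests may look at all scanned symbols at once. \<open>Query\<close> is the oracle call with the
  fixed query and answer tapes of the machine model. Tapes are numbered by all natural numbers, so that
  states can be updated as functions; a compiled machine owns those below some \<open>T\<close>.
\<close>

datatype com =
  Skip
| Put nat sym dir
| Mv nat dir
| Seq com com
| Cond "(nat \<Rightarrow> sym) \<Rightarrow> bool" com com
| While "(nat \<Rightarrow> sym) \<Rightarrow> bool" com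
| Query

fun next_cont :: "com list \<Rightarrow> (nat \<Rightarrow> sym) \<Rightarrow> com list" where
  "next_cont [] f = []"
| "next_cont (Seq a b # K) f = a # b # K"
| "next_cont (Cond p a b # K) f = (if p f then a else b) # K"
| "next_cont (While p a # K) f = (if p f then a # While p a # K else K)"
| "next_cont (c # K) f = K"

fun acts_of :: "com list \<Rightarrow> (nat \<Rightarrow> sym) \<Rightarrow> nat \<Rightarrow> sym \<times> dir" where
  "acts_of (Put t s d # K) f u = (if u = t then (s, d) else (f u, Stay))"
| "acts_of (Mv t d # K) f u = (f u, if u = t then d else Stay)"
| "acts_of _ f u = (f u, Stay)"

text \<open>
  Small steps on stacks of commands that are still to be executed. Each of them corresponds to exactly one
  step of the compiled machine, also those that only rearrange the stack.
\<close>

inductive cstep :: "(nat list \<Rightarrow> rat \<Rightarrow> bool) \<Rightarrow> com list \<times> mem \<Rightarrow> com list \<times> mem \<Rightarrow> bool"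
  for orc where
  ordinary: "\<lbrakk>C \<noteq> []; hd C \<noteq> Query\<rbrakk> \<Longrightarrow>
     cstep orc (C, m) (next_cont C (scan \<circ> m), \<lambda>u. act (acts_of C (scan \<circ> m) u) (m u))"
| query: "\<lbrakk>fst (m 1) = cells (encode_nats i); orc i r\<rbrakk> \<Longrightarrow>
     cstep orc (Query # K, m) (K, m(1 := word_tape [], 2 := word_tape (encode_rat r)))"

subsection \<open>Compilation\<close>

definition depends_below :: "nat \<Rightarrow> ((nat \<Rightarrow> sym) \<Rightarrow> bool) \<Rightarrow> bool" where
  "depends_below T p \<longleftrightarrow> (\<forall>f g. (\<forall>t<T. f t = g t) \<longrightarrow> p f = p g)"

primrec uses_tapes_below :: "nat \<Rightarrow> com \<Rightarrow> bool" where
  "uses_tapes_below T Skip \<longleftrightarrow> True"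
| "uses_tapes_below T (Put t s d) \<longleftrightarrow> t < T"
| "uses_tapes_below T (Mv t d) \<longleftrightarrow> t < T"
| "uses_tapes_below T (Seq a b) \<longleftrightarrow> uses_tapes_below T a \<and> uses_tapes_below T b"
| "uses_tapes_below T (Cond p a b) \<longleftrightarrow> depends_below T p \<and> uses_tapes_below T a \<and> uses_tapes_below T b"
| "uses_tapes_below T (While p a) \<longleftrightarrow> depends_below T p \<and> uses_tapes_below T a"
| "uses_tapes_below T Query \<longleftrightarrow> True"

primrec query_free :: "com \<Rightarrow> bool" where
  "query_free Skip \<longleftrightarrow> True"
| "query_free (Put t s d) \<longleftrightarrow> True"
| "query_free (Mv t d) \<longleftrightarrow> True"
| "query_free (Seq a b) \<longleftrightarrow> query_free a \<and> query_free b"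
| "query_free (Cond p a b) \<longleftrightarrow> query_free a \<and> query_free b"
| "query_free (While p a) \<longleftrightarrow> query_free a"
| "query_free Query \<longleftrightarrow> False"

text \<open>
  A finite set that contains every stack that can occur, on top of \<open>K\<close>, while \<open>c\<close> is being executed.
  The program text bounds the stack, because the body of a loop returns to the loop itself.
\<close>

primrec conts :: "com \<Rightarrow> com list \<Rightarrow> com list set" where
  "conts Skip K = {Skip # K}"
| "conts (Put t s d) K = {Put t s d # K}"
| "conts (Mv t d) K = {Mv t d # K}"
| "conts (Seq a b) K = insert (Seq a b # K) (conts a (b # K) \<union> conts b K)"
| "conts (Cond p a b) K = insert (Cond p a b # K) (conts a K \<union> conts b K)"
| "conts (While p a) K = insert (While p a # K) (conts a (While p a # K))"
| "conts Query K = {Query # K}"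

lemma finite_conts: "finite (conts c K)"
  by (induction c arbitrary: K) auto

lemma start_in_conts: "c # K \<in> conts c K"
  by (cases c) auto

lemma next_cont_in_conts: "C \<in> conts c K \<Longrightarrow> next_cont C f \<in> insert K (conts c K)"
proof (induction c arbitrary: K)
  case (Seq a b)
  then show ?case using start_in_conts[of a "b # K"] start_in_conts[of b K] by fastforce
next
  case (Cond p a b)
  then show ?case using Cond.IH(1)[of K] Cond.IH(2)[of K] start_in_conts[of a K] start_in_conts[of b K] by auto
next
  case (While p a)
  then show ?case using start_in_conts[of a "While p a # K"] by fastforce
qed auto

lemma uses_tapes_below_hd_conts: "C \<in> conts c K \<Longrightarrow> uses_tapes_below T c \<Longrightarrow> uses_tapes_below T (hd C)"
  by (induction c arbitrary: K) auto

lemma query_free_conts: "query_free c \<Longrightarrow> Query # K' \<notin> conts c K"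
  by (induction c arbitrary: K) auto

lemma next_cont_cong:
  assumes "C = [] \<or> uses_tapes_below T (hd C)" "\<And>t. t < T \<Longrightarrow> f t = g t"
  shows "next_cont C f = next_cont C g"
proof -
  have "p f = p g" if "depends_below T p" for p
    using that assms(2) by (auto simp: depends_below_def)
  then show ?thesis using assms(1) by (cases "(C, f)" rule: next_cont.cases) auto
qed

lemma acts_of_cong: "f u = g u \<Longrightarrow> acts_of C f u = acts_of C g u"
  by (cases "(C, f, u)" rule: acts_of.cases) auto

lemma map_upt_update: "t < T \<Longrightarrow> (map m [0..<T])[t := x] = map (m(t := x)) [0..<T]"
  by (rule nth_equalityI) (auto simp: nth_list_update)

text \<open>
  States are the numbers of the possible stacks. A machine has one query state with one reply state,
  so the stack left after a query has to be unique; this is why the program is required to have its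
  only query at one place of a single outer loop.
\<close>

lemma compile_query_loop:
  assumes P: "P = Seq I (While p (Seq E (Seq Query A)))"
    and qf: "query_free I" "query_free E" "query_free A"
    and tapes: "uses_tapes_below T P" and "4 \<le> T"
  shows "\<exists>M. wf_machine M \<and> num_tapes M = T \<and>
    (\<forall>orc m m'. (cstep orc)\<^sup>*\<^sup>* ([P], m) ([], m') \<longrightarrow>
       (step M orc)\<^sup>*\<^sup>* (start_state M, map m [0..<T]) (halt_state M, map m' [0..<T]))"
proof -
  define St where "St = insert [] (conts P [])"
  define K0 where "K0 = [A, While p (Seq E (Seq Query A))]"
  obtain e where e: "bij_betw e St {0..<card St}"
    using ex_bij_betw_finite_nat[of St] finite_conts by (auto simp: St_def)
  then have inj: "inj_on e St" and range: "\<And>C. C \<in> St \<Longrightarrow> e C < card St"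
    by (auto simp: bij_betw_def)
  define view where "view ss = (\<lambda>t. if t < T then ss ! t else Blank)" for ss
  define M where "M = \<lparr>num_states = card St, num_tapes = T, start_state = e [P], halt_state = e [],
    query_state = e (Query # K0), reply_state = e K0,
    trans = (\<lambda>q ss. let C = inv_into St e q in
       (e (next_cont C (view ss)), map (acts_of C (view ss)) [0..<T]))\<rparr>"
  \<comment> \<open>The commands that wait while the query is being answered.\<close>
  have K0: "Query # K0 \<in> St" "K0 \<in> St"
    using start_in_conts[of A] by (auto simp: St_def P K0_def)
  have unique: "K = K0" if "Query # K \<in> St" for K
    using that query_free_conts[OF qf(1)] query_free_conts[OF qf(2)] query_free_conts[OF qf(3)]
    by (auto simp: St_def P K0_def)
  have closed: "next_cont C f \<in> St" if "C \<in> St" for C f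
    using that next_cont_in_conts[of C P "[]" f] by (auto simp: St_def)
  have start: "[P] \<in> St"
    using start_in_conts by (simp add: St_def)
  have "wf_machine M"
    unfolding wf_machine_def
  proof (intro conjI allI impI)
    fix q and ss :: "sym list" assume "q < num_states M"
    then have "inv_into St e q \<in> St"
      using e by (auto simp: M_def bij_betw_def intro!: inv_into_into)
    then show "fst (trans M q ss) < num_states M"
      by (simp add: M_def Let_def range closed)
    show "length (snd (trans M q ss)) = num_tapes M"
      by (simp add: M_def Let_def)
  next
    show "halt_state M \<noteq> query_state M"
      using inj_onD[OF inj, of "[]" "Query # K0"] K0 by (auto simp: M_def St_def)
  qed (use \<open>4 \<le> T\<close> start K0 range in \<open>auto simp: M_def St_def\<close>)
  moreover have one: "C' \<in> St \<and> step M orc (e C, map m [0..<T]) (e C', map m' [0..<T])"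
    if "cstep orc (C, m) (C', m')" "C \<in> St" for orc C m C' m'
    using that(1)
  proof cases
    case ordinary
    have "e C \<noteq> halt_state M" "e C \<noteq> query_state M"
      using inj_onD[OF inj, of C "[]"] inj_onD[OF inj, of C "Query # K0"] ordinary that(2) K0
      by (auto simp: M_def St_def)
    moreover define f where "f = view (map scan (map m [0..<T]))"
    have f: "f t = (scan \<circ> m) t" if "t < T" for t
      using that by (simp add: f_def view_def)
    have "next_cont C f = C'"
      unfolding ordinary using that(2) uses_tapes_below_hd_conts[OF _ tapes] f
      by (intro next_cont_cong[of C T]) (auto simp: St_def)
    then have "trans M (e C) (map scan (map m [0..<T])) = (e C', map (acts_of C f) [0..<T])"
      using inv_into_f_f[OF inj that(2)] by (simp add: M_def Let_def f_def)
    ultimately have "step M orc (e C, map m [0..<T])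
        (e C', map2 act (map (acts_of C f) [0..<T]) (map m [0..<T]))"
      by (rule step.ordinary)
    moreover have "map2 act (map (acts_of C f) [0..<T]) (map m [0..<T]) = map m' [0..<T]"
      unfolding ordinary
    proof (rule nth_equalityI)
      fix u assume "u < length (map2 act (map (acts_of C f) [0..<T]) (map m [0..<T]))"
      then have "u < T" by simp
      moreover have "acts_of C f u = acts_of C (scan \<circ> m) u"
        by (rule acts_of_cong) (rule f[OF \<open>u < T\<close>])
      ultimately show "map2 act (map (acts_of C f) [0..<T]) (map m [0..<T]) ! u =
          map (\<lambda>u. act (acts_of C (scan \<circ> m) u) (m u)) [0..<T] ! u"
        by simp
    qed simp
    moreover have "C' \<in> St"
      unfolding ordinary using closed that(2) by blast
    ultimately show ?thesis by simp
  next
    case (query i r)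
    have "C' = K0"
      using unique query(1) that(2) by auto
    moreover have "step M orc (query_state M, map m [0..<T])
      (reply_state M, (map m [0..<T])[1 := word_tape [], 2 := word_tape (encode_rat r)])"
      by (rule step.query[where i = i]) (use query \<open>4 \<le> T\<close> in auto)
    ultimately show ?thesis
      using query K0 \<open>4 \<le> T\<close> by (simp add: M_def map_upt_update)
  qed
  moreover have "C' \<in> St \<and> (step M orc)\<^sup>*\<^sup>* (e [P], map m [0..<T]) (e C', map m' [0..<T])"
    if "(cstep orc)\<^sup>*\<^sup>* ([P], m) (C', m')" for orc m C' m'
    using that
  proof (induction rule: rtranclp_induct2)
    case (step C1 m1 C2 m2)
    then show ?case using one by (meson rtranclp.rtrancl_into_rtrancl)
  qed (simp add: start)
  ultimately show ?thesis
    by (intro exI[of _ M]) (auto simp: M_def)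
qed

subsection \<open>Runs of programs\<close>

text \<open>
  Quantifying over the stack \<open>K\<close> of pending commands makes runs composable.
\<close>

definition runs :: "(nat list \<Rightarrow> rat \<Rightarrow> bool) \<Rightarrow> com \<Rightarrow> mem \<Rightarrow> mem \<Rightarrow> bool" where
  "runs orc c m m' \<longleftrightarrow> (\<forall>K. (cstep orc)\<^sup>*\<^sup>* (c # K, m) (K, m'))"

lemma act_idle: "act (scan x, Stay) x = x"
  by (cases x) auto

lemma cstep_control:
  assumes "c \<noteq> Query" "\<And>t s d. c \<noteq> Put t s d" "\<And>t d. c \<noteq> Mv t d"
  shows "cstep orc (c # K, m) (next_cont (c # K) (scan \<circ> m), m)"
proof -
  have "(\<lambda>u. act (acts_of (c # K) (scan \<circ> m) u) (m u)) = m"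
    using assms by (cases c) (auto simp: act_idle)
  then show ?thesis
    using cstep.ordinary[of "c # K" orc m] assms by simp
qed

lemma runs_Skip: "runs orc Skip m m"
  unfolding runs_def using cstep_control[of Skip orc _ m] by auto

lemma runs_Put: "runs orc (Put t s d) m (m(t := act (s, d) (m t)))"
proof -
  have "(\<lambda>u. act (acts_of (Put t s d # K) (scan \<circ> m) u) (m u)) = m(t := act (s, d) (m t))" for K
    by (auto simp: act_idle)
  then show ?thesis
    unfolding runs_def using cstep.ordinary[of "Put t s d # _" orc m] by (auto intro!: r_into_rtranclp)
qed

lemma runs_Mv: "runs orc (Mv t d) m (m(t := (fst (m t), move d (snd (m t)))))"
proof -
  have "(\<lambda>u. act (acts_of (Mv t d # K) (scan \<circ> m) u) (m u)) =
      m(t := (fst (m t), move d (snd (m t))))" for K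
  proof
    fix u show "act (acts_of (Mv t d # K) (scan \<circ> m) u) (m u) = (m(t := (fst (m t), move d (snd (m t))))) u"
      by (cases "m u") (auto simp: act_idle)
  qed
  then show ?thesis
    unfolding runs_def using cstep.ordinary[of "Mv t d # _" orc m] by (auto intro!: r_into_rtranclp)
qed

lemma runs_Seq:
  assumes "runs orc a m m'" "runs orc b m' m''"
  shows "runs orc (Seq a b) m m''"
  unfolding runs_def
proof
  fix K
  have "cstep orc (Seq a b # K, m) (a # b # K, m)"
    using cstep_control[of "Seq a b"] by simp
  also have "(cstep orc)\<^sup>*\<^sup>* (a # b # K, m) (b # K, m')"
    using assms(1) by (simp add: runs_def)
  also have "(cstep orc)\<^sup>*\<^sup>* (b # K, m') (K, m'')"
    using assms(2) by (simp add: runs_def)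
  finally show "(cstep orc)\<^sup>*\<^sup>* (Seq a b # K, m) (K, m'')" .
qed

lemma cstep_Cond: "cstep orc (Cond p a b # K, m) ((if p (scan \<circ> m) then a else b) # K, m)"
  using cstep_control[of "Cond p a b"] by simp

lemma cstep_While: "cstep orc (While p a # K, m) (if p (scan \<circ> m) then a # While p a # K else K, m)"
  using cstep_control[of "While p a" orc K m] by simp

lemma runs_Cond:
  assumes "runs orc (if p (scan \<circ> m) then a else b) m m'"
  shows "runs orc (Cond p a b) m m'"
  using assms unfolding runs_def by (meson cstep_Cond converse_rtranclp_into_rtranclp)

text \<open>
  The loop is described by the sequence of its intermediate states, which replaces a loop invariant.
\<close>

lemma runs_While:
  assumes "\<And>i. i < n \<Longrightarrow> p (scan \<circ> m i) \<and> runs orc a (m i) (m (Suc i))"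
    and "\<not> p (scan \<circ> m n)"
  shows "runs orc (While p a) (m 0) (m n)"
proof -
  have "(cstep orc)\<^sup>*\<^sup>* (While p a # K, m 0) (While p a # K, m i)" if "i \<le> n" for i K
    using that
  proof (induction i)
    case (Suc i)
    have "cstep orc (While p a # K, m i) (a # While p a # K, m i)"
      using cstep_While[of orc p a K "m i"] assms(1)[of i] Suc.prems by simp
    also have "(cstep orc)\<^sup>*\<^sup>* (a # While p a # K, m i) (While p a # K, m (Suc i))"
      using assms(1)[of i] Suc.prems by (simp add: runs_def)
    finally show ?case using Suc by auto
  qed auto
  moreover have "cstep orc (While p a # K, m n) (K, m n)" for K
    using cstep_While[of orc p a K "m n"] assms(2) by simp
  ultimately show ?thesis
    unfolding runs_def by (meson order_refl rtranclp.rtrancl_into_rtrancl)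
qed

lemma runs_eq: "runs orc c m m' \<Longrightarrow> m' = m'' \<Longrightarrow> runs orc c m m''"
  by simp

subsection \<open>Counters\<close>

text \<open>
  A unary number behind a marker in cell 0. As the content of a tape it serves as a counter from 0 to \<open>n\<close>, whose
  value is the head position: the marker \<open>Sep\<close> signals 0, and a blank signals that \<open>n\<close> has been passed.
\<close>

definition bar :: "nat \<Rightarrow> int \<Rightarrow> sym" where
  "bar n = cells (Sep # replicate n Stroke)"

lemma bar_eq: "bar n i = (if i = 0 then Sep else if 0 < i \<and> i \<le> int n then Stroke else Blank)"
  by (auto simp: bar_def cells_def nth_Cons' nat_less_iff)

lemma bar_eq_Sep_iff: "bar n (int v) = Sep \<longleftrightarrow> v = 0"
  by (simp add: bar_eq)

lemma bar_eq_Blank_iff: "bar n (int v) = Blank \<longleftrightarrow> v > n"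
  by (simp add: bar_eq)

lemma bar_extend: "(bar n)(int (Suc n) := Stroke) = bar (Suc n)"
  by (auto simp: bar_eq fun_eq_iff)

lemma cells_snoc: "(cells w)(int (length w) := s) = cells (w @ [s])"
proof
  fix i show "((cells w)(int (length w) := s)) i = cells (w @ [s]) i"
    by (cases "i = int (length w)") (auto simp: cells_def nth_append nat_less_iff)
qed

lemma bar_start: "(cells [])(0 := Sep) = bar 0"
  using cells_snoc[of "[]" Sep] by (simp add: bar_def)

definition rewind :: "nat \<Rightarrow> com" where
  "rewind t = Seq (Mv t GoLeft) (While (\<lambda>f. f t \<noteq> Sep) (Mv t GoLeft))"

lemma runs_rewind:
  assumes "m t = (bar n, int (Suc v))"
  shows "runs orc (rewind t) m (m(t := (bar n, 0)))"
proof -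
  define m1 where "m1 i = m(t := (bar n, int (v - i)))" for i
  have "runs orc (Mv t GoLeft) m (m1 0)"
    by (rule runs_eq[OF runs_Mv]) (simp add: m1_def assms)
  moreover have "runs orc (While (\<lambda>f. f t \<noteq> Sep) (Mv t GoLeft)) (m1 0) (m1 v)"
  proof (rule runs_While)
    fix i assume "i < v"
    then have "runs orc (Mv t GoLeft) (m1 i) (m1 (Suc i))"
      by (intro runs_eq[OF runs_Mv]) (auto simp: m1_def)
    with \<open>i < v\<close> show "(scan \<circ> m1 i) t \<noteq> Sep \<and> runs orc (Mv t GoLeft) (m1 i) (m1 (Suc i))"
      by (simp add: m1_def bar_eq_Sep_iff del: of_nat_diff)
  qed (use bar_eq_Sep_iff[of n 0] in \<open>simp add: m1_def\<close>)
  ultimately show ?thesis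
    unfolding rewind_def by (auto intro!: runs_Seq simp: m1_def)
qed

text \<open>
  Copies a block of the input to two tapes. The head of tape \<open>x\<close> is rewound to 0, and
  \<open>x\<close> will be a running counter; the head of \<open>y\<close> stays at the value of the block, which thereby
  remains available as a constant while \<open>x\<close> moves.
\<close>

definition load :: "nat \<Rightarrow> nat \<Rightarrow> com" where
  "load x y = Seq (Put x Sep GoRight) (Seq (Put y Sep GoRight) (Seq
     (While (\<lambda>f. f 0 = Stroke) (Seq (Mv 0 GoRight) (Seq (Put x Stroke GoRight) (Put y Stroke GoRight))))
     (Seq (Mv 0 GoRight) (Seq (rewind x) (Mv y GoLeft)))))"

lemma runs_load:
  assumes xy: "x \<noteq> 0" "y \<noteq> 0" "x \<noteq> y"
    and m: "m 0 = (g, p)" "m x = word_tape []" "m y = word_tape []"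
    and g: "\<And>i. i < n \<Longrightarrow> g (p + int i) = Stroke" "g (p + int n) \<noteq> Stroke"
  shows "runs orc (load x y) m (m(0 := (g, p + int n + 1), x := (bar n, 0), y := (bar n, int n)))"
proof -
  define m1 where "m1 i = m(0 := (g, p + int i), x := (bar i, int (Suc i)), y := (bar i, int (Suc i)))" for i
  have 1: "runs orc (Put x Sep GoRight) m (m(x := (bar 0, 1)))"
    by (rule runs_eq[OF runs_Put]) (simp add: m word_tape_def bar_start)
  have 2: "runs orc (Put y Sep GoRight) (m(x := (bar 0, 1))) (m1 0)"
    by (rule runs_eq[OF runs_Put]) (use xy in \<open>auto simp: m m1_def word_tape_def bar_start fun_eq_iff\<close>)
  have 3: "runs orc (While (\<lambda>f. f 0 = Stroke) (Seq (Mv 0 GoRight)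
      (Seq (Put x Stroke GoRight) (Put y Stroke GoRight)))) (m1 0) (m1 n)"
  proof (rule runs_While)
    fix i assume i: "i < n"
    have "runs orc (Mv 0 GoRight) (m1 i) ((m1 i)(0 := (g, p + int (Suc i))))"
      by (rule runs_eq[OF runs_Mv]) (use xy in \<open>auto simp: m1_def fun_eq_iff\<close>)
    moreover have "runs orc (Put x Stroke GoRight) ((m1 i)(0 := (g, p + int (Suc i))))
        ((m1 i)(0 := (g, p + int (Suc i)), x := (bar (Suc i), int (Suc (Suc i)))))"
      by (rule runs_eq[OF runs_Put]) (use xy bar_extend[of i] in \<open>simp add: m1_def\<close>)
    moreover have "runs orc (Put y Stroke GoRight)
        ((m1 i)(0 := (g, p + int (Suc i)), x := (bar (Suc i), int (Suc (Suc i))))) (m1 (Suc i))"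
      by (rule runs_eq[OF runs_Put])
        (use xy bar_extend[of i] in \<open>auto simp: m1_def fun_eq_iff\<close>)
    ultimately show "(scan \<circ> m1 i) 0 = Stroke \<and> runs orc (Seq (Mv 0 GoRight)
        (Seq (Put x Stroke GoRight) (Put y Stroke GoRight))) (m1 i) (m1 (Suc i))"
      using g(1)[OF i] xy by (auto simp: m1_def intro!: runs_Seq)
  qed (use g(2) xy in \<open>simp add: m1_def\<close>)
  have 4: "runs orc (Mv 0 GoRight) (m1 n) ((m1 n)(0 := (g, p + int n + 1)))"
    by (rule runs_eq[OF runs_Mv]) (use xy in \<open>auto simp: m1_def fun_eq_iff\<close>)
  have 5: "runs orc (rewind x) ((m1 n)(0 := (g, p + int n + 1)))
      ((m1 n)(0 := (g, p + int n + 1), x := (bar n, 0)))"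
    by (rule runs_rewind[where v = n]) (use xy in \<open>simp add: m1_def\<close>)
  have 6: "runs orc (Mv y GoLeft) ((m1 n)(0 := (g, p + int n + 1), x := (bar n, 0)))
      (m(0 := (g, p + int n + 1), x := (bar n, 0), y := (bar n, int n)))"
    by (rule runs_eq[OF runs_Mv]) (use xy in \<open>auto simp: m1_def fun_eq_iff\<close>)
  show ?thesis
    unfolding load_def by (intro runs_Seq[OF 1] runs_Seq[OF 2] runs_Seq[OF 3] runs_Seq[OF 4] runs_Seq[OF 5] 6)
qed

text \<open>
  Appends the current value of a counter to the query tape. Reading a head position destroys it, so
  the distance is also measured on the ruler, tape 4, which then guides the head back.
\<close>

definition emit :: "nat \<Rightarrow> com" where
  "emit t = Seq
     (While (\<lambda>f. f t \<noteq> Sep) (Seq (Mv t GoLeft) (Seq (Put 1 Stroke GoRight) (Mv 4 GoRight))))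
     (While (\<lambda>f. f 4 \<noteq> Sep) (Seq (Mv 4 GoLeft) (Mv t GoRight)))"

lemma runs_emit:
  assumes t: "t \<noteq> 1" "t \<noteq> 4"
    and m: "m t = (bar n, int v)" "m 1 = (cells w, int (length w))" "m 4 = (bar 0, 0)"
  shows "runs orc (emit t) m (m(1 := (cells (w @ replicate v Stroke), int (length w + v))))"
proof -
  define q where "q i = (cells (w @ replicate i Stroke), int (length w + i))" for i
  define m1 where "m1 i = m(t := (bar n, int (v - i)), 1 := q i, 4 := (bar 0, int i))" for i
  define m2 where "m2 i = m(t := (bar n, int i), 1 := q v, 4 := (bar 0, int (v - i)))" for i
  have q_Suc: "act (Stroke, GoRight) (q i) = q (Suc i)" for i
    using cells_snoc[of "w @ replicate i Stroke" Stroke]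
    by (simp add: q_def replicate_append_same)
  have down: "runs orc (While (\<lambda>f. f t \<noteq> Sep) (Seq (Mv t GoLeft) (Seq (Put 1 Stroke GoRight) (Mv 4 GoRight))))
      (m1 0) (m1 v)"
  proof (rule runs_While)
    fix i assume i: "i < v"
    have "runs orc (Mv t GoLeft) (m1 i) ((m1 i)(t := (bar n, int (v - Suc i))))"
      by (rule runs_eq[OF runs_Mv]) (use t i in \<open>auto simp: m1_def fun_eq_iff\<close>)
    moreover have "runs orc (Put 1 Stroke GoRight) ((m1 i)(t := (bar n, int (v - Suc i))))
        ((m1 i)(t := (bar n, int (v - Suc i)), 1 := q (Suc i)))"
      by (rule runs_eq[OF runs_Put]) (use t q_Suc in \<open>auto simp: m1_def fun_eq_iff\<close>)
    moreover have "runs orc (Mv 4 GoRight) ((m1 i)(t := (bar n, int (v - Suc i)), 1 := q (Suc i))) (m1 (Suc i))"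
      by (rule runs_eq[OF runs_Mv]) (use t in \<open>auto simp: m1_def fun_eq_iff\<close>)
    ultimately show "(scan \<circ> m1 i) t \<noteq> Sep \<and>
        runs orc (Seq (Mv t GoLeft) (Seq (Put 1 Stroke GoRight) (Mv 4 GoRight))) (m1 i) (m1 (Suc i))"
      using i t by (auto simp: m1_def bar_eq_Sep_iff simp del: of_nat_diff intro!: runs_Seq)
  qed (use t bar_eq_Sep_iff[of n 0] in \<open>simp add: m1_def\<close>)
  have up: "runs orc (While (\<lambda>f. f 4 \<noteq> Sep) (Seq (Mv 4 GoLeft) (Mv t GoRight))) (m2 0) (m2 v)"
  proof (rule runs_While)
    fix i assume i: "i < v"
    have "runs orc (Mv 4 GoLeft) (m2 i) ((m2 i)(4 := (bar 0, int (v - Suc i))))"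
      by (rule runs_eq[OF runs_Mv]) (use t i in \<open>auto simp: m2_def fun_eq_iff\<close>)
    moreover have "runs orc (Mv t GoRight) ((m2 i)(4 := (bar 0, int (v - Suc i)))) (m2 (Suc i))"
      by (rule runs_eq[OF runs_Mv]) (use t in \<open>auto simp: m2_def fun_eq_iff\<close>)
    ultimately show "(scan \<circ> m2 i) 4 \<noteq> Sep \<and> runs orc (Seq (Mv 4 GoLeft) (Mv t GoRight)) (m2 i) (m2 (Suc i))"
      using i t by (auto simp: m2_def bar_eq_Sep_iff simp del: of_nat_diff intro!: runs_Seq)
  qed (use t bar_eq_Sep_iff[of 0 0] in \<open>simp add: m2_def\<close>)
  have "m1 v = m2 0" and ends: "m1 0 = m" "m2 v = m(1 := q v)"
    using t m by (auto simp: m1_def m2_def q_def fun_eq_iff)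
  then have "runs orc (emit t) (m1 0) (m2 v)"
    unfolding emit_def using down up by (intro runs_Seq[of _ _ _ "m1 v"]) simp_all
  then show ?thesis
    unfolding ends q_def .
qed

text \<open>
  The component of a name is the sum of the counters on the tapes \<open>ts\<close>, since juxtaposed blocks of
  strokes add up.
\<close>

definition emit_number :: "nat list \<Rightarrow> com" where
  "emit_number ts = foldr (\<lambda>t. Seq (emit t)) ts (Put 1 Sep GoRight)"

definition emit_name :: "nat list list \<Rightarrow> com" where
  "emit_name gs = foldr (\<lambda>g. Seq (emit_number g)) gs Skip"

lemma runs_emit_number:
  assumes "\<forall>t\<in>set ts. 5 \<le> t \<and> m t = (bar (N t), int (\<rho> t))"
    and "m 1 = (cells w, int (length w))" "m 4 = (bar 0, 0)"
  shows "runs orc (emit_number ts) m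
    (m(1 := (cells (w @ encode_nats [\<Sum>t\<leftarrow>ts. \<rho> t]), int (length w + length (encode_nats [\<Sum>t\<leftarrow>ts. \<rho> t])))))"
  using assms
proof (induction ts arbitrary: m w)
  case Nil
  then show ?case
    using cells_snoc[of w Sep]
    by (auto simp: emit_number_def encode_nats_def intro!: runs_eq[OF runs_Put])
next
  case (Cons t ts)
  define w' where "w' = w @ replicate (\<rho> t) Stroke"
  have 1: "runs orc (emit t) m (m(1 := (cells w', int (length w'))))"
    using runs_emit[of t m "N t" "\<rho> t" w orc] Cons.prems by (auto simp: w'_def)
  have 2: "runs orc (emit_number ts) (m(1 := (cells w', int (length w'))))
     (m(1 := (cells (w @ encode_nats [\<Sum>t\<leftarrow>t # ts. \<rho> t]), int (length w + length (encode_nats [\<Sum>t\<leftarrow>t # ts. \<rho> t])))))"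
    by (rule runs_eq[OF Cons.IH[where w = w']])
      (use Cons.prems in \<open>auto simp: w'_def encode_nats_def replicate_add\<close>)
  show ?case
    using runs_Seq[OF 1 2] unfolding emit_number_def foldr.simps comp_apply .
qed

lemma runs_emit_name:
  assumes "\<forall>t\<in>\<Union>(set ` set gs). 5 \<le> t \<and> m t = (bar (N t), int (\<rho> t))"
    and "m 1 = (cells w, int (length w))" "m 4 = (bar 0, 0)"
  defines "w' \<equiv> w @ encode_nats (map (\<lambda>g. \<Sum>t\<leftarrow>g. \<rho> t) gs)"
  shows "runs orc (emit_name gs) m (m(1 := (cells w', int (length w'))))"
  using assms(1-3) unfolding w'_def
proof (induction gs arbitrary: m w)
  case Nil
  then show ?case
    by (auto simp: emit_name_def encode_nats_def fun_upd_idem intro!: runs_eq[OF runs_Skip])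
next
  case (Cons g gs)
  define w1 where "w1 = w @ encode_nats [\<Sum>t\<leftarrow>g. \<rho> t]"
  have 1: "runs orc (emit_number g) m (m(1 := (cells w1, int (length w1))))"
    using runs_emit_number[of g m N \<rho> w orc] Cons.prems by (auto simp: w1_def)
  have pre: "\<forall>t\<in>\<Union>(set ` set gs). 5 \<le> t \<and>
      (m(1 := (cells w1, int (length w1)))) t = (bar (N t), int (\<rho> t))"
  proof
    fix t assume "t \<in> \<Union>(set ` set gs)"
    then have "5 \<le> t" "m t = (bar (N t), int (\<rho> t))"
      using Cons.prems(1) by auto
    then show "5 \<le> t \<and> (m(1 := (cells w1, int (length w1)))) t = (bar (N t), int (\<rho> t))"
      by simp
  qed
  have 2: "runs orc (emit_name gs) (m(1 := (cells w1, int (length w1))))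
     (m(1 := (cells (w @ encode_nats (map (\<lambda>g. \<Sum>t\<leftarrow>g. \<rho> t) (g # gs))),
        int (length (w @ encode_nats (map (\<lambda>g. \<Sum>t\<leftarrow>g. \<rho> t) (g # gs)))))))"
    by (rule runs_eq[OF Cons.IH[OF pre, where w = w1]])
      (use Cons.prems in \<open>auto simp: w1_def encode_nats_def\<close>)
  show ?case
    using runs_Seq[OF 1 2] unfolding emit_name_def foldr.simps comp_apply .
qed

section \<open>A machine for bounded quantifier prefixes\<close>

text \<open>
  The intended result of the search. A level \<open>(t, e)\<close> is a quantifier over the value of counter \<open>t\<close> up to
  \<open>N t\<close>, existential if \<open>e\<close> holds; the first level is the outermost one.
\<close>

primrec search :: "(nat \<times> bool) list \<Rightarrow> (nat \<Rightarrow> nat) \<Rightarrow> ((nat \<Rightarrow> nat) \<Rightarrow> bool) \<Rightarrow> (nat \<Rightarrow> nat) \<Rightarrow> bool" where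
  "search [] N \<phi> \<rho> = \<phi> \<rho>"
| "search (l # ls) N \<phi> \<rho> =
     (if snd l then \<exists>v\<le>N (fst l). search ls N \<phi> (\<rho>(fst l := v))
      else \<forall>v\<le>N (fst l). search ls N \<phi> (\<rho>(fst l := v)))"

text \<open>
  One move of the odometer, with the levels listed from the innermost outwards, after a subtree of the search
  has been evaluated to the symbol on the answer tape 2. If that value decides the quantifier of this level,
  or if the range of its counter is exhausted, then the value of the whole level is that very symbol, because the
  earlier values of the counter were not decisive. So the counter is reset and the next outer level takes over
  with the answer tape unchanged. When no level is left, the result is written on the output tape 3.
\<close>

primrec advance :: "(nat \<times> bool) list \<Rightarrow> com" where
  "advance [] = Cond (\<lambda>f. f 2 = Stroke)
     (Seq (Put 3 Stroke GoRight) (Seq (Put 3 Sep GoRight) (Put 3 Stroke Stay)))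
     (Seq (Put 3 Sep GoRight) (Put 3 Stroke Stay))"
| "advance (l # ls) = Seq (Mv (fst l) GoRight)
     (Cond (\<lambda>f. (f 2 = Stroke) = snd l \<or> f (fst l) = Blank) (Seq (rewind (fst l)) (advance ls)) Skip)"

text \<open>
  The output tape, blank until the end, serves as the loop condition.
\<close>

definition search_loop :: "(nat \<times> bool) list \<Rightarrow> nat list list \<Rightarrow> com" where
  "search_loop ls gs = While (\<lambda>f. f 3 = Blank) (Seq (emit_name gs) (Seq Query (advance (rev ls))))"

text \<open>
  The state between two moves of the odometer: counters \<open>\<rho>\<close> on the tapes from 5 on, the ruler on tape 4 and
  the last answer \<open>A\<close> on tape 2.
\<close>

definition sweep_state :: "tape \<Rightarrow> (nat \<Rightarrow> nat) \<Rightarrow> (nat \<Rightarrow> nat) \<Rightarrow> tape \<Rightarrow> mem" where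
  "sweep_state I N \<rho> A t =
     (if t = 0 then I else if t = 2 then A else if t < 4 then word_tape []
      else if t = 4 then (bar 0, 0) else (bar (N t), int (\<rho> t)))"

definition answer :: "bool \<Rightarrow> tape" where
  "answer b = word_tape (encode_rat (of_bool b))"

lemma encode_rat_of_bool: "encode_rat (of_bool b) = (if b then [Stroke, Sep, Stroke] else [Sep, Stroke])"
  by (simp add: encode_rat_def)

lemma scan_answer: "scan (answer b) = (if b then Stroke else Sep)"
  by (simp add: answer_def word_tape_def encode_rat_of_bool cells_def)

lemma sweep_state_update:
  "5 \<le> t \<Longrightarrow> (sweep_state I N \<rho> A)(t := (bar (N t), int v)) = sweep_state I N (\<rho>(t := v)) A"
  by (auto simp: sweep_state_def fun_eq_iff)

lemma advance_step:
  assumes "5 \<le> fst l" "v \<le> N (fst l)"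
  shows "(cstep orc)\<^sup>*\<^sup>* (advance (l # ls) # K, sweep_state I N (\<rho>(fst l := v)) (answer b))
    (if b = snd l \<or> v = N (fst l)
     then (advance ls # K, sweep_state I N (\<rho>(fst l := 0)) (answer b))
     else (K, sweep_state I N (\<rho>(fst l := Suc v)) (answer b)))"
proof -
  define t where "t = fst l"
  define p where "p = (\<lambda>f. (f 2 = Stroke) = snd l \<or> f t = Blank)"
  define m where "m = sweep_state I N (\<rho>(t := Suc v)) (answer b)"
  have t: "5 \<le> t" "v \<le> N t"
    using assms by (auto simp: t_def)
  have m_t: "m t = (bar (N t), int (Suc v))"
    using t by (simp add: m_def sweep_state_def)
  have p: "p (scan \<circ> m) \<longleftrightarrow> b = snd l \<or> v = N t"
    using t bar_eq_Blank_iff[of "N t" "Suc v"] m_t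
    by (auto simp: p_def m_def sweep_state_def scan_answer)
  have 1: "cstep orc (advance (l # ls) # K, sweep_state I N (\<rho>(t := v)) (answer b))
      (Mv t GoRight # Cond p (Seq (rewind t) (advance ls)) Skip # K, sweep_state I N (\<rho>(t := v)) (answer b))"
    using cstep_control[of "advance (l # ls)" orc K] by (simp add: p_def t_def)
  have "runs orc (Mv t GoRight) (sweep_state I N (\<rho>(t := v)) (answer b)) m"
    by (rule runs_eq[OF runs_Mv]) (use t in \<open>auto simp: m_def sweep_state_def fun_eq_iff\<close>)
  then have 2: "(cstep orc)\<^sup>*\<^sup>*
      (Mv t GoRight # Cond p (Seq (rewind t) (advance ls)) Skip # K, sweep_state I N (\<rho>(t := v)) (answer b))
      (Cond p (Seq (rewind t) (advance ls)) Skip # K, m)"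
    by (simp add: runs_def)
  have 3: "cstep orc (Cond p (Seq (rewind t) (advance ls)) Skip # K, m)
      ((if p (scan \<circ> m) then Seq (rewind t) (advance ls) else Skip) # K, m)"
    by (rule cstep_Cond)
  have 4: "(cstep orc)\<^sup>*\<^sup>* ((if p (scan \<circ> m) then Seq (rewind t) (advance ls) else Skip) # K, m) (if p (scan \<circ> m)
      then (advance ls # K, sweep_state I N (\<rho>(t := 0)) (answer b)) else (K, m))"
  proof (cases "p (scan \<circ> m)")
    case True
    have "cstep orc (Seq (rewind t) (advance ls) # K, m) (rewind t # advance ls # K, m)"
      using cstep_control[of "Seq (rewind t) (advance ls)" orc K m] by simp
    also have "runs orc (rewind t) m (sweep_state I N (\<rho>(t := 0)) (answer b))"
      by (rule runs_eq[OF runs_rewind[of m t "N t" v, OF m_t]])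
        (use sweep_state_update[OF t(1), where v = 0] in \<open>simp add: m_def\<close>)
    then have "(cstep orc)\<^sup>*\<^sup>* (rewind t # advance ls # K, m)
        (advance ls # K, sweep_state I N (\<rho>(t := 0)) (answer b))"
      by (simp add: runs_def)
    finally show ?thesis
      using True by simp
  next
    case False
    then show ?thesis
      using runs_Skip[of orc m] by (simp add: runs_def)
  qed
  from converse_rtranclp_into_rtranclp[of "cstep orc", OF 1 rtranclp_trans[OF 2
        converse_rtranclp_into_rtranclp[of "cstep orc", OF 3 4]]]
  show ?thesis
    unfolding p unfolding m_def t_def .
qed

text \<open>
  Started with the counters of the inner levels \<open>ls\<close> at 0, the loop comes to the point where the
  outer levels \<open>us\<close> are advanced, with the inner counters at 0 again and the value of the inner
  search on the answer tape. The proof is by induction on the inner levels; for one level it runs through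
  the values of its counter from any \<open>v\<close> upwards.
\<close>

lemma search_sweep:
  assumes reply: "\<And>\<rho>. orc (map (\<lambda>g. \<Sum>t\<leftarrow>g. \<rho> t) gs) (of_bool (\<phi> \<rho>))"
    and gs: "\<And>t. t \<in> \<Union>(set ` set gs) \<Longrightarrow> 5 \<le> t"
    and all: "rev us @ ls = all" "distinct (map fst ls)" "\<And>l. l \<in> set ls \<Longrightarrow> 5 \<le> fst l"
    and zero: "\<And>l. l \<in> set ls \<Longrightarrow> \<rho> (fst l) = 0"
  shows "(cstep orc)\<^sup>*\<^sup>* ([search_loop all gs], sweep_state I N \<rho> A)
     ([advance us, search_loop all gs], sweep_state I N \<rho> (answer (search ls N \<phi> \<rho>)))"
  using all zero
proof (induction ls arbitrary: us \<rho> A)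
  case Nil
  let ?m = "sweep_state I N \<rho> A" and ?b = "advance us" and ?W = "search_loop all gs"
  define w where "w = encode_nats (map (\<lambda>g. \<Sum>t\<leftarrow>g. \<rho> t) gs)"
  define m where "m = ?m(1 := (cells w, int (length w)))"
  have us: "rev all = us"
    using Nil by auto
  have "(cstep orc)\<^sup>*\<^sup>* ([?W], ?m) ([Seq (emit_name gs) (Seq Query ?b), ?W], ?m)"
    using cstep_While[of orc "\<lambda>f. f 3 = Blank" "Seq (emit_name gs) (Seq Query ?b)" "[]" ?m]
    by (intro r_into_rtranclp) (simp add: search_loop_def us sweep_state_def word_tape_def cells_def)
  also have "cstep orc \<dots> ([emit_name gs, Seq Query ?b, ?W], ?m)"
    using cstep_control[of "Seq (emit_name gs) (Seq Query ?b)" orc "[?W]" ?m] by simp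
  also have "runs orc (emit_name gs) ?m m"
    unfolding m_def w_def
    by (rule runs_eq[OF runs_emit_name[where w = "[]" and N = N and \<rho> = \<rho>]])
      (use gs in \<open>force simp: sweep_state_def word_tape_def\<close>)+
  then have "(cstep orc)\<^sup>*\<^sup>* ([emit_name gs, Seq Query ?b, ?W], ?m) ([Seq Query ?b, ?W], m)"
    by (simp add: runs_def)
  also have "cstep orc ([Seq Query ?b, ?W], m) ([Query, ?b, ?W], m)"
    using cstep_control[of "Seq Query ?b" orc "[?W]" m] by simp
  also have "cstep orc ([Query, ?b, ?W], m)
      ([?b, ?W], sweep_state I N \<rho> (answer (search [] N \<phi> \<rho>)))"
  proof -
    have "m(1 := word_tape [], 2 := word_tape (encode_rat (of_bool (\<phi> \<rho>)))) =
        sweep_state I N \<rho> (answer (search [] N \<phi> \<rho>))"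
      by (rule ext) (simp add: m_def sweep_state_def answer_def)
    moreover have "cstep orc ([Query, ?b, ?W], m)
        ([?b, ?W], m(1 := word_tape [], 2 := word_tape (encode_rat (of_bool (\<phi> \<rho>)))))"
      by (rule cstep.query[where i = "map (\<lambda>g. \<Sum>t\<leftarrow>g. \<rho> t) gs"]) (simp_all add: m_def w_def reply)
    ultimately show ?thesis by metis
  qed
  finally show ?case .
next
  case (Cons l ls)
  define t where "t = fst l"
  have t: "5 \<le> t" "\<rho> t = 0" "t \<notin> fst ` set ls"
    using Cons.prems by (auto simp: t_def)
  \<comment> \<open>The value of the level when the counter has arrived at \<open>v\<close> and all smaller values were indecisive.\<close>
  define goal where "goal v \<longleftrightarrow> (if snd l then \<exists>v'\<in>{v..N t}. search ls N \<phi> (\<rho>(t := v'))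
    else \<forall>v'\<in>{v..N t}. search ls N \<phi> (\<rho>(t := v')))" for v
  have "(cstep orc)\<^sup>*\<^sup>* ([search_loop all gs], sweep_state I N (\<rho>(t := v)) A)
     ([advance us, search_loop all gs], sweep_state I N (\<rho>(t := 0)) (answer (goal v)))"
    if "v \<le> N t" for v A
    using that
  proof (induction "N t - v" arbitrary: v A)
    case (0 v A)
    let ?b = "search ls N \<phi> (\<rho>(t := v))"
    have v: "v = N t"
      using 0 by simp
    have 1: "(cstep orc)\<^sup>*\<^sup>* ([search_loop all gs], sweep_state I N (\<rho>(t := v)) A)
        ([advance (l # us), search_loop all gs], sweep_state I N (\<rho>(t := v)) (answer ?b))"
      using Cons.prems t by (intro Cons.IH) (auto simp: image_iff)
    have 2: "(cstep orc)\<^sup>*\<^sup>* ([advance (l # us), search_loop all gs], sweep_state I N (\<rho>(t := v)) (answer ?b))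
        ([advance us, search_loop all gs], sweep_state I N (\<rho>(t := 0)) (answer ?b))"
      using advance_step[of l v N orc us "[search_loop all gs]" I \<rho> ?b] v t by (simp add: t_def)
    have "goal v = ?b"
      by (simp add: goal_def v)
    then show ?case
      using rtranclp_trans[OF 1 2] by (simp only:)
  next
    case (Suc d v A)
    let ?b = "search ls N \<phi> (\<rho>(t := v))"
    have v: "v \<noteq> N t" "Suc v \<le> N t" "d = N t - Suc v"
      using Suc.hyps by auto
    have goal_split: "goal v = (if snd l then ?b \<or> goal (Suc v) else ?b \<and> goal (Suc v))"
      unfolding goal_def atLeastAtMost_insertL[OF Suc.prems, symmetric] by auto
    have 1: "(cstep orc)\<^sup>*\<^sup>* ([search_loop all gs], sweep_state I N (\<rho>(t := v)) A)
        ([advance (l # us), search_loop all gs], sweep_state I N (\<rho>(t := v)) (answer ?b))"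
      using Cons.prems t by (intro Cons.IH) (auto simp: image_iff)
    note 2 = advance_step[of l v N orc us "[search_loop all gs]" I \<rho> ?b, folded t_def, OF t(1) Suc.prems]
    show ?case
    proof (cases "?b = snd l")
      case True
      then have "goal v = ?b" using goal_split by auto
      moreover have "(cstep orc)\<^sup>*\<^sup>* ([advance (l # us), search_loop all gs], sweep_state I N (\<rho>(t := v)) (answer ?b))
          ([advance us, search_loop all gs], sweep_state I N (\<rho>(t := 0)) (answer ?b))"
        using 2 True by simp
      ultimately show ?thesis
        using rtranclp_trans[OF 1] by (simp only:)
    next
      case False
      then have "goal v = goal (Suc v)" using goal_split by auto
      moreover have "(cstep orc)\<^sup>*\<^sup>* ([advance (l # us), search_loop all gs], sweep_state I N (\<rho>(t := v)) (answer ?b))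
          ([search_loop all gs], sweep_state I N (\<rho>(t := Suc v)) (answer ?b))"
        using 2 False v(1) by simp
      moreover have "(cstep orc)\<^sup>*\<^sup>* ([search_loop all gs], sweep_state I N (\<rho>(t := Suc v)) (answer ?b))
          ([advance us, search_loop all gs], sweep_state I N (\<rho>(t := 0)) (answer (goal (Suc v))))"
        by (rule Suc.hyps(1)[OF v(3) v(2)])
      ultimately show ?thesis
        using rtranclp_trans[OF 1 rtranclp_trans] by (simp only:)
    qed
  qed
  from this[of 0 A] have "(cstep orc)\<^sup>*\<^sup>* ([search_loop all gs], sweep_state I N (\<rho>(t := 0)) A)
     ([advance us, search_loop all gs], sweep_state I N (\<rho>(t := 0)) (answer (goal 0)))"
    by blast
  moreover have "goal 0 = search (l # ls) N \<phi> \<rho>"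
    by (auto simp: goal_def t_def)
  moreover have "\<rho>(t := 0) = \<rho>"
    using t(2) by (rule fun_upd_idem)
  ultimately show ?case
    by (simp only:)
qed

subsection \<open>Reading the input\<close>

text \<open>
  Block \<open>j\<close> of the input goes to the running counter on tape \<open>5 + 2 * j\<close> and to the constant on tape
  \<open>6 + 2 * j\<close>, so running counters have odd numbers and constants have even ones.
\<close>

definition bound :: "nat list \<Rightarrow> nat \<Rightarrow> nat" where
  "bound ns t = (if (t - 5) div 2 < length ns then ns ! ((t - 5) div 2) else 0)"

definition initial_counters :: "nat list \<Rightarrow> nat \<Rightarrow> nat" where
  "initial_counters ns t = (if even t then bound ns t else 0)"

text \<open>
  The state after \<open>j\<close> blocks of the input have been read. The machine has no tapes from
  \<open>5 + 2 * length ns\<close> on; the values given to them here are those that let the final state be a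
  \<open>sweep_state\<close> for all tape numbers.
\<close>

definition loaded :: "nat list \<Rightarrow> nat \<Rightarrow> mem" where
  "loaded ns j t =
     (if t = 0 then (cells (encode_nats ns), int (length (encode_nats (take j ns))))
      else if t < 4 then word_tape [] else if t = 4 then (bar 0, 0)
      else if j \<le> (t - 5) div 2 \<and> (t - 5) div 2 < length ns then word_tape []
      else (bar (bound ns t), int (initial_counters ns t)))"

definition load_from :: "nat \<Rightarrow> nat \<Rightarrow> com" where
  "load_from j r = foldr (\<lambda>j. Seq (load (5 + 2 * j) (6 + 2 * j))) [j..<r] Skip"

lemma cells_at_offset: "i < length v \<Longrightarrow> cells (u @ v) (int (length u) + int i) = v ! i"
  by (auto simp: cells_def nth_append nat_add_distrib)

lemma runs_load_loaded:
  assumes "j < length ns"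
  shows "runs orc (load (5 + 2 * j) (6 + 2 * j)) (loaded ns j) (loaded ns (Suc j))"
proof -
  define u where "u = encode_nats (take j ns)"
  define w where "w = encode_nats (drop (Suc j) ns)"
  have enc: "encode_nats ns = u @ (replicate (ns ! j) Stroke @ [Sep]) @ w"
    by (subst id_take_nth_drop[OF assms]) (simp add: u_def w_def encode_nats_def)
  have enc': "encode_nats (take (Suc j) ns) = u @ replicate (ns ! j) Stroke @ [Sep]"
    using assms by (simp add: take_Suc_conv_app_nth u_def encode_nats_def)
  have j: "(5 + 2 * j - 5) div 2 = j" "(6 + 2 * j - 5) div 2 = j"
    by auto
  have other: "(t - 5) div 2 \<noteq> j" if "t \<noteq> 5 + 2 * j" "t \<noteq> 6 + 2 * j" "\<not> t < 5" for t
    using that by presburger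
  show ?thesis
  proof (rule runs_eq[OF runs_load])
    show "cells (encode_nats ns) (int (length u) + int i) = Stroke" if "i < ns ! j" for i
      unfolding enc using that by (subst cells_at_offset) (auto simp: nth_append)
    show "cells (encode_nats ns) (int (length u) + int (ns ! j)) \<noteq> Stroke"
      unfolding enc by (subst cells_at_offset) (auto simp: nth_append)
    show "(loaded ns j)(0 := (cells (encode_nats ns), int (length u) + int (ns ! j) + 1),
      5 + 2 * j := (bar (ns ! j), 0), 6 + 2 * j := (bar (ns ! j), int (ns ! j))) = loaded ns (Suc j)"
      (is "?l = ?r")
    proof
      fix t show "?l t = ?r t"
      proof (cases "t = 5 + 2 * j \<or> t = 6 + 2 * j \<or> t < 5")
        case True
        then show ?thesis
          using assms j by (auto simp: loaded_def bound_def initial_counters_def enc')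
      next
        case False
        then have "(Suc j \<le> (t - 5) div 2) = (j \<le> (t - 5) div 2)"
          using other[of t] by linarith
        then show ?thesis
          using False by (simp add: loaded_def)
      qed
    qed
  qed (use assms j in \<open>simp_all add: loaded_def u_def\<close>)
qed

lemma runs_load_from:
  "j \<le> length ns \<Longrightarrow> runs orc (load_from j (length ns)) (loaded ns j) (loaded ns (length ns))"
proof (induction rule: inc_induct)
  case base
  then show ?case by (simp add: load_from_def runs_Skip)
next
  case (step j)
  then show ?case
    using runs_Seq[OF runs_load_loaded[OF step(2)] step(3)]
    by (simp add: load_from_def upt_conv_Cons)
qed

lemma loaded_all:
  "loaded ns (length ns) = sweep_state (cells (encode_nats ns), int (length (encode_nats ns)))
     (bound ns) (initial_counters ns) (word_tape [])"
  by (auto simp: loaded_def sweep_state_def fun_eq_iff)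

subsection \<open>The complete program\<close>

lemma query_free_foldr: "(\<And>x. x \<in> set xs \<Longrightarrow> query_free (f x)) \<Longrightarrow> query_free c \<Longrightarrow> query_free (foldr (\<lambda>x. Seq (f x)) xs c)"
  by (induction xs) auto

lemma uses_tapes_below_foldr:
  "(\<And>x. x \<in> set xs \<Longrightarrow> uses_tapes_below T (f x)) \<Longrightarrow> uses_tapes_below T c \<Longrightarrow>
    uses_tapes_below T (foldr (\<lambda>x. Seq (f x)) xs c)"
  by (induction xs) auto

lemma query_free_advance: "query_free (advance ls)"
  by (induction ls) (auto simp: rewind_def)

lemma query_free_emit_name: "query_free (emit_name gs)"
  by (auto simp: emit_name_def emit_number_def emit_def intro!: query_free_foldr)

lemma query_free_load_from: "query_free (load_from j r)"
  by (auto simp: load_from_def load_def rewind_def intro!: query_free_foldr)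

lemma uses_tapes_below_advance:
  "5 \<le> T \<Longrightarrow> \<forall>l\<in>set ls. fst l < T \<Longrightarrow> uses_tapes_below T (advance ls)"
  by (induction ls) (auto simp: rewind_def depends_below_def)

lemma uses_tapes_below_emit_name:
  "5 \<le> T \<Longrightarrow> \<forall>t\<in>\<Union>(set ` set gs). t < T \<Longrightarrow> uses_tapes_below T (emit_name gs)"
  by (auto simp: emit_name_def emit_number_def emit_def depends_below_def intro!: uses_tapes_below_foldr)

lemma uses_tapes_below_load_from: "5 + 2 * r \<le> T \<Longrightarrow> uses_tapes_below T (load_from j r)"
  by (auto simp: load_from_def load_def rewind_def depends_below_def intro!: uses_tapes_below_foldr)

lemma advance_output:
  "\<exists>m. runs orc (advance []) (sweep_state I N \<rho> (answer b)) m \<and>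
     fst (m 3) = cells (encode_rat (of_bool b)) \<and> scan (m 3) = Stroke"
proof -
  let ?m = "sweep_state I N \<rho> (answer b)"
  have m3: "?m 3 = (cells [], 0)" and m2: "scan (?m 2) = (if b then Stroke else Sep)"
    by (simp_all add: sweep_state_def word_tape_def scan_answer)
  have snoc: "(cells w)(i := s) = cells (w @ [s])" if "i = int (length w)" for w i s
    using cells_snoc that by simp
  show ?thesis
  proof (cases b)
    case True
    have "runs orc (Seq (Put 3 Stroke GoRight) (Seq (Put 3 Sep GoRight) (Put 3 Stroke Stay))) ?m
        (?m(3 := (cells [Stroke, Sep, Stroke], 2)))"
      by (intro runs_Seq[OF runs_Put] runs_eq[OF runs_Put]) (simp add: m3 snoc)
    then have "runs orc (advance []) ?m (?m(3 := (cells [Stroke, Sep, Stroke], 2)))"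
      unfolding advance.simps by (intro runs_Cond) (use True m2 in simp)
    then show ?thesis
      by (intro exI[of _ "?m(3 := (cells [Stroke, Sep, Stroke], 2))"])
        (use encode_rat_of_bool[of b] True in \<open>simp add: cells_def\<close>)
  next
    case False
    have "runs orc (Seq (Put 3 Sep GoRight) (Put 3 Stroke Stay)) ?m
        (?m(3 := (cells [Sep, Stroke], 1)))"
      by (intro runs_Seq[OF runs_Put] runs_eq[OF runs_Put]) (simp add: m3 snoc)
    then have "runs orc (advance []) ?m (?m(3 := (cells [Sep, Stroke], 1)))"
      unfolding advance.simps by (intro runs_Cond) (use False m2 in simp)
    then show ?thesis
      by (intro exI[of _ "?m(3 := (cells [Sep, Stroke], 1))"])
        (use encode_rat_of_bool[of b] False in \<open>simp add: cells_def\<close>)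
  qed
qed

text \<open>
  The levels and the groups of tapes are fixed in the program, while the bounds of the search come from the
  input. The machine is independent of the oracle and of the predicate \<open>\<phi>\<close> that the oracle answers.
\<close>

theorem search_machine:
  assumes ls: "distinct (map fst ls)" "\<And>l. l \<in> set ls \<Longrightarrow> odd (fst l) \<and> 5 \<le> fst l \<and> fst l < 5 + 2 * r"
    and gs: "\<And>t. t \<in> \<Union>(set ` set gs) \<Longrightarrow> 5 \<le> t \<and> t < 5 + 2 * r"
  shows "\<exists>M. wf_machine M \<and> (\<forall>orc ns \<phi>. length ns = r \<longrightarrow>
     (\<forall>\<rho>. orc (map (\<lambda>g. \<Sum>t\<leftarrow>g. \<rho> t) gs) (of_bool (\<phi> \<rho>))) \<longrightarrow>
     computes M orc ns (of_bool (search ls (bound ns) \<phi> (initial_counters ns))))"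
proof -
  define T where "T = 5 + 2 * r"
  define Init where "Init = Seq (Put 4 Sep Stay) (load_from 0 r)"
  define P where "P = Seq Init (search_loop ls gs)"
  have "query_free Init"
    using query_free_load_from by (simp add: Init_def)
  moreover have "uses_tapes_below T P"
    unfolding P_def Init_def search_loop_def
    using ls gs by (auto simp: T_def depends_below_def intro!: uses_tapes_below_load_from
        uses_tapes_below_emit_name uses_tapes_below_advance)
  ultimately obtain M where M: "wf_machine M" "num_tapes M = T"
    and sim: "\<And>orc m m'. (cstep orc)\<^sup>*\<^sup>* ([P], m) ([], m') \<Longrightarrow>
       (step M orc)\<^sup>*\<^sup>* (start_state M, map m [0..<T]) (halt_state M, map m' [0..<T])"
    using compile_query_loop[of P Init "\<lambda>f. f 3 = Blank" "emit_name gs" "advance (rev ls)" T]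
      query_free_emit_name query_free_advance
    unfolding P_def search_loop_def T_def by fastforce
  have "computes M orc ns (of_bool (search ls (bound ns) \<phi> (initial_counters ns)))"
    if ns: "length ns = r" and reply: "\<And>\<rho>. orc (map (\<lambda>g. \<Sum>t\<leftarrow>g. \<rho> t) gs) (of_bool (\<phi> \<rho>))" for orc ns \<phi>
  proof -
    let ?b = "search ls (bound ns) \<phi> (initial_counters ns)" and ?W = "search_loop ls gs"
    define I where "I = (cells (encode_nats ns), int (length (encode_nats ns)))"
    \<comment> \<open>The blank tapes at the start agree with \<open>loaded ns 0\<close> except for the marker on the ruler.\<close>
    define m0 where "m0 = (loaded ns 0)(4 := word_tape [])"
    define m1 where "m1 = sweep_state I (bound ns) (initial_counters ns)"
    obtain m where m: "runs orc (advance []) (m1 (answer ?b)) m"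
      "fst (m 3) = cells (encode_rat (of_bool ?b))" "scan (m 3) = Stroke"
      using advance_output unfolding m1_def by blast
    have "runs orc (Put 4 Sep Stay) m0 (loaded ns 0)"
      by (rule runs_eq[OF runs_Put])
        (auto simp: m0_def loaded_def fun_eq_iff word_tape_def bar_start[unfolded fun_eq_iff, simplified])
    then have init: "runs orc Init m0 (m1 (word_tape []))"
      unfolding Init_def m1_def I_def loaded_all[symmetric] ns[symmetric]
      using runs_load_from[of 0 ns orc] by (auto intro: runs_Seq)
    have "cstep orc ([P], m0) ([Init, ?W], m0)"
      using cstep_control[of P orc "[]" m0] by (simp add: P_def)
    also have "(cstep orc)\<^sup>*\<^sup>* ([Init, ?W], m0) ([?W], m1 (word_tape []))"
      using init by (simp add: runs_def)
    also have "(cstep orc)\<^sup>*\<^sup>* ([?W], m1 (word_tape [])) ([advance [], ?W], m1 (answer ?b))"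
      unfolding m1_def
      by (rule search_sweep) (use ls gs reply in \<open>auto simp: initial_counters_def\<close>)
    also have "(cstep orc)\<^sup>*\<^sup>* ([advance [], ?W], m1 (answer ?b)) ([?W], m)"
      using m(1) by (simp add: runs_def)
    also have "cstep orc ([?W], m) ([], m)"
      using cstep_While[of orc "\<lambda>f. f 3 = Blank" _ "[]" m] m(3) by (simp add: search_loop_def)
    finally have "(step M orc)\<^sup>*\<^sup>* (start_state M, map m0 [0..<T]) (halt_state M, map m [0..<T])"
      by (rule sim)
    moreover have "initial_config M ns = (start_state M, map m0 [0..<T])"
    proof -
      have "word_tape (encode_nats ns) # replicate (T - 1) (word_tape []) = map m0 [0..<T]"
        by (rule nth_equalityI)
          (auto simp: m0_def loaded_def T_def nth_Cons' word_tape_def encode_nats_def ns)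
      then show ?thesis by (simp add: initial_config_def M(2))
    qed
    ultimately show ?thesis
      unfolding computes_def using m(2) by (intro exI[of _ "map m [0..<T]"]) (simp add: T_def)
  qed
  with M(1) show ?thesis by blast
qed

section \<open>Towers of bounded quantifiers\<close>

definition index_range :: "nat list \<Rightarrow> nat set" where
  "index_range ns = (case ns of [] \<Rightarrow> UNIV | n # _ \<Rightarrow> {..n})"

text \<open>
  The alternating prefix with its first quantifiers bounded by the indices that are given in \<open>ns\<close> and
  the remaining ones unbounded. Lists of all lengths are treated together, so that this one function
  describes the algorithms, all the intermediate limits and, for the empty list, \<open>\<Xi>\<close> itself. Unused indices are handed to
  the matrix \<open>\<phi>\<close>.
\<close>

primrec bounded_prefix :: "nat \<Rightarrow> nat list \<Rightarrow> (nat list \<Rightarrow> nat list \<Rightarrow> bool) \<Rightarrow> bool" where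
  "bounded_prefix 0 ns \<phi> = \<phi> ns []"
| "bounded_prefix (Suc l) ns \<phi> =
     (if even (Suc l) then \<exists>m\<in>index_range ns. bounded_prefix l (tl ns) (\<lambda>ns' ms. \<phi> ns' (m # ms))
      else \<forall>m\<in>index_range ns. bounded_prefix l (tl ns) (\<lambda>ns' ms. \<phi> ns' (m # ms)))"

text \<open>
  The statement ``column \<open>i\<close> is infinite'' and its approximations: first ``there is a 1 in a row from \<open>y\<close> on'', then
  the same for the rows from \<open>y\<close> to \<open>y + z\<close>.
\<close>

definition column_search :: "array \<Rightarrow> nat list \<Rightarrow> nat list \<Rightarrow> nat \<Rightarrow> bool" where
  "column_search a ns ms i =
     (case ns of [] \<Rightarrow> \<exists>\<^sub>\<infinity>n. a (ms @ [n, i]) = 1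
      | y # ns' \<Rightarrow> \<exists>d\<in>index_range ns'. a (ms @ [y + d, i]) = 1)"

definition P_search :: "array \<Rightarrow> nat list \<Rightarrow> nat list \<Rightarrow> bool" where
  "P_search a ns ms \<longleftrightarrow> (\<exists>i\<in>index_range ns. column_search a (tl ns) ms i)"

text \<open>
  In \<open>Q\<close> the first index \<open>x\<close> is a candidate for the column from which on all columns are infinite, and
  the second index bounds two quantifiers at once, those over the columns and over the rows.
\<close>

definition Q_search :: "array \<Rightarrow> nat list \<Rightarrow> nat list \<Rightarrow> bool" where
  "Q_search a ns ms =
     (case ns of [] \<Rightarrow> \<forall>\<^sub>\<infinity>i. column_search a [] ms i
      | x # ns' \<Rightarrow> \<forall>e\<in>index_range ns'. column_search a ns' ms (x + e))"

lemma index_range_simps [simp]: "index_range [] = UNIV" "index_range (n # ns) = {..n}"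
  by (simp_all add: index_range_def)

subsection \<open>Convergence\<close>

lemma eventually_bounded_ex: "\<forall>\<^sub>F n in sequentially. (\<exists>m\<in>{..n}. p m) = (\<exists>m::nat. p m)"
proof (cases "\<exists>m. p m")
  case True
  then obtain m where "p m" by blast
  show ?thesis
    using eventually_ge_at_top[of m] by eventually_elim (use \<open>p m\<close> in auto)
qed auto

lemma eventually_bounded_all: "\<forall>\<^sub>F n in sequentially. (\<forall>m\<in>{..n}. p m) = (\<forall>m::nat. p m)"
  using eventually_bounded_ex[of "\<lambda>m. \<not> p m"] by eventually_elim blast

lemma shift_quantifier:
  "(\<exists>d. p (n + d)) \<longleftrightarrow> (\<exists>i\<ge>n. p i)" "(\<forall>d. p (n + d)) \<longleftrightarrow> (\<forall>i\<ge>n. p i)" for n :: nat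
  by (auto simp: le_iff_add)

text \<open>
  The new index either bounds the outermost unbounded quantifier, whose bound then tends to infinity,
  or belongs to the matrix. In both cases only finitely many instances lie inside the quantifiers that
  are already bounded, so they become constant simultaneously.
\<close>

lemma bounded_prefix_converges:
  assumes "\<And>ns ms. length ns \<le> 2 \<Longrightarrow> \<forall>\<^sub>F n in sequentially. \<phi> (ns @ [n]) ms = \<phi> ns ms"
    and "length ns \<le> l + 2"
  shows "\<forall>\<^sub>F n in sequentially. bounded_prefix l (ns @ [n]) \<phi> = bounded_prefix l ns \<phi>"
  using assms
proof (induction l arbitrary: ns \<phi>)
  case (Suc l)
  show ?case
  proof (cases ns)
    case Nil
    let ?p = "\<lambda>m. bounded_prefix l [] (\<lambda>ns' ms. \<phi> ns' (m # ms))"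
    show ?thesis
      using eventually_bounded_ex[of ?p] eventually_bounded_all[of ?p]
      by eventually_elim (simp add: Nil)
  next
    case (Cons x ns')
    have "\<forall>\<^sub>F n in sequentially. \<forall>m\<in>{..x}.
        bounded_prefix l (ns' @ [n]) (\<lambda>ns' ms. \<phi> ns' (m # ms)) =
        bounded_prefix l ns' (\<lambda>ns' ms. \<phi> ns' (m # ms))"
    proof (intro eventually_ball_finite ballI)
      fix m
      show "\<forall>\<^sub>F n in sequentially. bounded_prefix l (ns' @ [n]) (\<lambda>ns' ms. \<phi> ns' (m # ms)) =
        bounded_prefix l ns' (\<lambda>ns' ms. \<phi> ns' (m # ms))"
        by (rule Suc.IH) (use Suc.prems Cons in simp_all)
    qed simp
    then show ?thesis
      by eventually_elim (simp add: Cons)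
  qed
qed simp

lemma bounded_prefix_Nil: "bounded_prefix l [] \<phi> = alternate l (\<phi> [])"
  by (induction l arbitrary: \<phi>) simp_all

lemma column_search_converges:
  assumes "length ns \<le> 1"
  shows "\<forall>\<^sub>F n in sequentially. column_search a (ns @ [n]) ms i = column_search a ns ms i"
proof (cases ns)
  case Nil
  let ?p = "\<lambda>n. a (ms @ [n, i]) = 1"
  have "\<forall>\<^sub>F y in sequentially. (\<exists>n\<ge>y. ?p n) = (\<exists>\<^sub>\<infinity>n. ?p n)"
  proof (cases "\<exists>\<^sub>\<infinity>n. ?p n")
    case True
    then show ?thesis by (simp add: INFM_nat_le)
  next
    case False
    then obtain N where "\<And>n. n \<ge> N \<Longrightarrow> \<not> ?p n"
      by (auto simp: INFM_nat_le)
    then have "\<not> (\<exists>n\<ge>y. ?p n)" if "y \<ge> N" for y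
      using that le_trans by blast
    then show ?thesis
      using False by (auto simp only: eventually_sequentially)
  qed
  then have "\<forall>\<^sub>F y in sequentially. (\<exists>d. ?p (y + d)) = (\<exists>\<^sub>\<infinity>n. ?p n)"
    by (simp only: shift_quantifier(1)[where p = ?p])
  then show ?thesis
    by (simp add: Nil column_search_def)
next
  case (Cons y ns')
  then show ?thesis
    using assms eventually_bounded_ex[of "\<lambda>d. a (ms @ [y + d, i]) = 1"]
    by (simp add: column_search_def)
qed

lemma P_search_converges:
  assumes "length ns \<le> 2"
  shows "\<forall>\<^sub>F n in sequentially. P_search a (ns @ [n]) ms = P_search a ns ms"
proof (cases ns)
  case Nil
  then show ?thesis
    using eventually_bounded_ex[of "column_search a [] ms"] by (simp add: P_search_def)
next
  case (Cons x ns')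
  have "\<forall>\<^sub>F n in sequentially. \<forall>i\<in>{..x}. column_search a (ns' @ [n]) ms i = column_search a ns' ms i"
    using assms Cons by (intro eventually_ball_finite ballI column_search_converges) auto
  then show ?thesis
    by eventually_elim (simp add: P_search_def Cons)
qed

text \<open>
  Only the step from \<open>[x, y]\<close> to \<open>[x]\<close> is not a plain bounded quantifier: if a column
  \<open>x + e\<close> is finite, then the approximation fails as soon as \<open>y\<close> exceeds \<open>e\<close> and the last 1 of that column.
\<close>

lemma Q_search_converges:
  assumes "length ns \<le> 2"
  shows "\<forall>\<^sub>F n in sequentially. Q_search a (ns @ [n]) ms = Q_search a ns ms"
proof -
  consider "ns = []" | x where "ns = [x]" | x y where "ns = [x, y]"
    using assms by (cases ns rule: remdups_adj.cases) auto
  then show ?thesis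
  proof cases
    case 1
    let ?S = "column_search a [] ms"
    have "\<forall>\<^sub>F n in sequentially. (\<forall>i\<ge>n. ?S i) = (\<forall>\<^sub>\<infinity>i. ?S i)"
    proof (cases "\<forall>\<^sub>\<infinity>i. ?S i")
      case True
      then obtain N where "\<And>i. i \<ge> N \<Longrightarrow> ?S i"
        by (auto simp: MOST_nat_le)
      then have "\<forall>i\<ge>n. ?S i" if "n \<ge> N" for n
        using that le_trans by blast
      then show ?thesis
        using True by (auto simp only: eventually_sequentially)
    next
      case False
      then have "\<not> (\<forall>i\<ge>n. ?S i)" for n
        unfolding MOST_nat_le by blast
      with False show ?thesis
        by (intro always_eventually allI) blast
    qed
    then have "\<forall>\<^sub>F n in sequentially. (\<forall>e. ?S (n + e)) = (\<forall>\<^sub>\<infinity>i. ?S i)"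
      by (simp only: shift_quantifier(2)[where p = ?S])
    then show ?thesis
      by (simp add: 1 Q_search_def)
  next
    case (2 x)
    have "\<forall>\<^sub>F y in sequentially. (\<forall>e\<in>{..y}. column_search a [y] ms (x + e)) = (\<forall>e. column_search a [] ms (x + e))"
    proof (cases "\<forall>e. column_search a [] ms (x + e)")
      case True
      have "column_search a [y] ms i" if "column_search a [] ms i" for y i
        using that shift_quantifier(1)[of "\<lambda>n. a (ms @ [n, i]) = 1" y]
        by (simp add: column_search_def INFM_nat_le)
      with True show ?thesis by simp
    next
      case False
      then obtain e where e: "\<not> column_search a [] ms (x + e)" by blast
      have "\<forall>\<^sub>F y in sequentially. column_search a [y] ms (x + e) = column_search a [] ms (x + e)"
        using column_search_converges[of "[]"] by simp
      with eventually_ge_at_top[of e] show ?thesis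
        by eventually_elim (use e in auto)
    qed
    then show ?thesis
      by (simp add: 2 Q_search_def)
  next
    case (3 x y)
    have "\<forall>\<^sub>F z in sequentially. \<forall>e\<in>{..y}. column_search a ([y] @ [z]) ms (x + e) = column_search a [y] ms (x + e)"
      by (intro eventually_ball_finite ballI column_search_converges) auto
    then show ?thesis
      by eventually_elim (simp add: 3 Q_search_def)
  qed
qed

subsection \<open>Dependence on finitely many entries\<close>

text \<open>
  With all quantifiers bounded, only index tuples up to the largest bound matter.
\<close>

lemma bounded_prefix_cong:
  assumes "\<And>ms. length ms = l \<Longrightarrow> set ms \<subseteq> {..B} \<Longrightarrow> \<phi> (drop l ns) ms = \<psi> (drop l ns) ms"
    and "l \<le> length ns" "set ns \<subseteq> {..B}"
  shows "bounded_prefix l ns \<phi> = bounded_prefix l ns \<psi>"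
  using assms
proof (induction l arbitrary: ns \<phi> \<psi>)
  case (Suc l)
  then obtain x ns' where ns: "ns = x # ns'"
    by (cases ns) auto
  have "bounded_prefix l ns' (\<lambda>ns' ms. \<phi> ns' (m # ms)) = bounded_prefix l ns' (\<lambda>ns' ms. \<psi> ns' (m # ms))"
    if "m \<le> x" for m
    by (rule Suc.IH) (use Suc.prems ns that in auto)
  then show ?case
    by (auto simp: ns)
qed simp

lemma column_search_cong:
  assumes "length ns = 2" "set ns \<subseteq> {..B}" "length ms + 2 = k" "set ms \<subseteq> {..B}" "i \<le> 2 * B"
    and ab: "\<And>ms'. length ms' = k \<Longrightarrow> set ms' \<subseteq> {..2 * B} \<Longrightarrow> a ms' = b ms'"
  shows "column_search a ns ms i = column_search b ns ms i"
proof -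
  obtain y z where ns: "ns = [y, z]"
    using assms(1) by (metis (no_types, lifting) One_nat_def Suc_1 length_0_conv length_Suc_conv)
  have "y \<le> B" "z \<le> B" and ms: "\<And>m. m \<in> set ms \<Longrightarrow> m \<le> 2 * B"
    using assms(2,4) by (auto simp: ns)
  then have "a (ms @ [y + d, i]) = b (ms @ [y + d, i])" if "d \<le> z" for d
    using assms(3,5) that by (intro ab) auto
  then show ?thesis
    by (auto simp: ns column_search_def)
qed

lemma P_search_cong:
  assumes "length ns = 3" "set ns \<subseteq> {..B}" "length ms + 2 = k" "set ms \<subseteq> {..B}"
    and ab: "\<And>ms'. length ms' = k \<Longrightarrow> set ms' \<subseteq> {..2 * B} \<Longrightarrow> a ms' = b ms'"
  shows "P_search a ns ms = P_search b ns ms"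
proof -
  obtain x ns' where ns: "ns = x # ns'" "length ns' = 2"
    using assms(1) by (cases ns) auto
  have "column_search a ns' ms i = column_search b ns' ms i" if "i \<le> x" for i
    by (rule column_search_cong[where B = B and k = k]) (use assms ns that in auto)
  then show ?thesis
    by (auto simp: ns P_search_def)
qed

lemma Q_search_cong:
  assumes "length ns = 3" "set ns \<subseteq> {..B}" "length ms + 2 = k" "set ms \<subseteq> {..B}"
    and ab: "\<And>ms'. length ms' = k \<Longrightarrow> set ms' \<subseteq> {..2 * B} \<Longrightarrow> a ms' = b ms'"
  shows "Q_search a ns ms = Q_search b ns ms"
proof -
  obtain x ns' where ns: "ns = x # ns'" "length ns' = 2"
    using assms(1) by (cases ns) auto
  then obtain y ns'' where ns': "ns' = y # ns''"
    by (cases ns') auto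
  have "column_search a ns' ms (x + e) = column_search b ns' ms (x + e)" if "e \<le> y" for e
    by (rule column_search_cong[where B = B and k = k]) (use assms ns ns' that in auto)
  then show ?thesis
    by (auto simp: ns ns' Q_search_def)
qed

subsection \<open>The search machine evaluates the tower\<close>

lemma bound_counter: "i < length ns \<Longrightarrow> bound ns (5 + 2 * i) = ns ! i"
  by (simp add: bound_def)

text \<open>
  The levels of the machine follow the prefix from position \<open>j\<close> on, the first \<open>j\<close> indices being those
  that the outer counters show. The constants on the even tapes are not touched by the search,
  and \<open>tl_levels\<close> may rely on them.
\<close>

lemma search_bounded_prefix:
  assumes "l \<le> length ns" "j \<le> l"
    and tail: "\<And>\<rho>. (\<And>t. even t \<Longrightarrow> \<rho> t = bound ns t) \<Longrightarrow>
      search tl_levels (bound ns) \<phi> \<rho> = C (drop l ns) (map (\<lambda>i. \<rho> (5 + 2 * i)) [0..<l])"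
    and "\<And>t. even t \<Longrightarrow> \<rho> t = bound ns t"
  shows "search (map (\<lambda>j. (5 + 2 * j, even (l - j))) [j..<l] @ tl_levels) (bound ns) \<phi> \<rho> =
    bounded_prefix (l - j) (drop j ns) (\<lambda>ns' ms. C ns' (map (\<lambda>i. \<rho> (5 + 2 * i)) [0..<j] @ ms))"
  using \<open>j \<le> l\<close> assms(4)
proof (induction arbitrary: \<rho> rule: inc_induct)
  case base
  then show ?case by (simp add: tail)
next
  case (step j)
  let ?ls = "map (\<lambda>j. (5 + 2 * j, even (l - j))) [Suc j..<l] @ tl_levels"
  have d: "l - j = Suc (l - Suc j)" "drop j ns = ns ! j # drop (Suc j) ns"
    using step.hyps assms(1) by (auto simp: Cons_nth_drop_Suc)
  have "search ?ls (bound ns) \<phi> (\<rho>(5 + 2 * j := v)) =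
      bounded_prefix (l - Suc j) (drop (Suc j) ns) (\<lambda>ns' ms. C ns' (map (\<lambda>i. \<rho> (5 + 2 * i)) [0..<j] @ v # ms))" for v
  proof -
    have "map (\<lambda>i. (\<rho>(5 + 2 * j := v)) (5 + 2 * i)) [0..<Suc j] = map (\<lambda>i. \<rho> (5 + 2 * i)) [0..<j] @ [v]"
      by simp
    moreover have "search ?ls (bound ns) \<phi> (\<rho>(5 + 2 * j := v)) =
      bounded_prefix (l - Suc j) (drop (Suc j) ns)
        (\<lambda>ns' ms. C ns' (map (\<lambda>i. (\<rho>(5 + 2 * j := v)) (5 + 2 * i)) [0..<Suc j] @ ms))"
      by (rule step.IH) (use step.prems in auto)
    ultimately show ?thesis
      by (simp only: append_assoc append_Cons append_Nil)
  qed
  moreover have "bound ns (5 + 2 * j) = ns ! j"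
    using step.hyps assms(1) by (intro bound_counter) auto
  moreover have "map (\<lambda>j. (5 + 2 * j, even (l - j))) [j..<l] @ tl_levels = (5 + 2 * j, even (l - j)) # ?ls"
    using step.hyps by (simp only: upt_conv_Cons list.map append_Cons)
  ultimately show ?case
    by (simp only: d bounded_prefix.simps search.simps fst_conv snd_conv index_range_simps list.sel
        Bex_def Ball_def atMost_iff)
qed

lemma search_P_levels:
  assumes "N x = n_x" "N d = n_d" "\<rho> y = n_y" "distinct [x, d, y]"
    and idx: "\<And>i. i \<in> set js \<Longrightarrow> f i \<notin> {x, d}"
  shows "search [(x, True), (d, True)] N
      (\<lambda>\<rho>. a (map (\<lambda>i. \<rho> (f i)) js @ map (\<lambda>g. \<Sum>t\<leftarrow>g. \<rho> t) [[y, d], [x]]) = 1) \<rho> \<longleftrightarrow>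
    P_search a [n_x, n_y, n_d] (map (\<lambda>i. \<rho> (f i)) js)"
proof -
  have "map (\<lambda>i. (\<rho>(x := v, d := w)) (f i)) js @
      map (\<lambda>g. \<Sum>t\<leftarrow>g. (\<rho>(x := v, d := w)) t) [[y, d], [x]] = map (\<lambda>i. \<rho> (f i)) js @ [n_y + w, v]" for v w
    using assms(3,4) idx by auto
  then show ?thesis
    unfolding P_search_def column_search_def
    by (simp only: search.simps fst_conv snd_conv if_True assms(1,2) index_range_simps list.sel list.case
        Bex_def atMost_iff)
qed

text \<open>
  Here the second index is needed twice, as the bound of the running counter \<open>e\<close> and as the
  constant \<open>y\<close> that shifts the rows; this is why each block of the input is loaded to two tapes.
\<close>

lemma search_Q_levels:
  assumes "N e = n_y" "N d = n_d" "\<rho> x = n_x" "\<rho> y = n_y" "distinct [x, d, y, e]"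
    and idx: "\<And>i. i \<in> set js \<Longrightarrow> f i \<notin> {e, d}"
  shows "search [(e, False), (d, True)] N
      (\<lambda>\<rho>. a (map (\<lambda>i. \<rho> (f i)) js @ map (\<lambda>g. \<Sum>t\<leftarrow>g. \<rho> t) [[y, d], [x, e]]) = 1) \<rho> \<longleftrightarrow>
    Q_search a [n_x, n_y, n_d] (map (\<lambda>i. \<rho> (f i)) js)"
proof -
  have "map (\<lambda>i. (\<rho>(e := v, d := w)) (f i)) js @
      map (\<lambda>g. \<Sum>t\<leftarrow>g. (\<rho>(e := v, d := w)) t) [[y, d], [x, e]] = map (\<lambda>i. \<rho> (f i)) js @ [n_y + w, n_x + v]" for v w
    using assms(3-5) idx by auto
  then show ?thesis
    unfolding Q_search_def column_search_def
    by (simp only: search.simps fst_conv snd_conv if_True if_False simp_thms assms(1,2) index_range_simps list.sel list.case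
        Bex_def Ball_def atMost_iff)
qed

lemma computational_Xi_problem:
  assumes "\<M> = two_point_space \<or> \<M> = unit_interval_space"
  shows "computational_problem (Xi_problem R k \<M>)"
proof -
  have "a = b" if ab: "a \<in> Omega k" "b \<in> Omega k"
    and eq: "\<forall>h\<in>evaluations (Xi_problem R k \<M>). h a = h b" for a b
  proof (rule PiE_ext[OF ab[unfolded Omega_def]])
    fix ms :: "nat list" assume "ms \<in> {ms. length ms = k}"
    then have "of_nat (a ms) = (of_nat (b ms) :: complex)"
      using eq by (auto simp: evaluations_def Xi_problem_def)
    then show "a ms = b ms" by simp
  qed
  moreover have "Xi R k a \<in> mspace \<M>" for a
    using assms by (auto simp: mspace_two_point_space mspace_unit_interval_space Xi_def)
  ultimately show ?thesis
    by (auto simp: computational_problem_def Xi_problem_def)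
qed

lemma limitin_of_bool:
  assumes "\<M> = two_point_space \<or> \<M> = unit_interval_space"
    and "\<forall>\<^sub>F n in sequentially. p n = q"
  shows "limitin (mtopology_of \<M>) (\<lambda>n. of_bool (p n)) (of_bool q) sequentially"
proof (rule limitin_eventually)
  show "of_bool q \<in> topspace (mtopology_of \<M>)"
    using assms(1) by (auto simp: mspace_two_point_space mspace_unit_interval_space)
  show "\<forall>\<^sub>F n in sequentially. (of_bool (p n) :: real) = of_bool q"
    using assms(2) by eventually_elim simp
qed

text \<open>
  A bounded search may be taken to query one and the same finite set of entries for every array, which makes
  the consistency condition on the query sets trivial.
\<close>

lemma general_algorithm_fixed_queries:
  fixes f :: "array \<Rightarrow> real"
  assumes "\<And>a. a \<in> Omega k \<Longrightarrow> f a \<in> mspace \<M>"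
    and "\<And>a b. \<lbrakk>a \<in> Omega k; b \<in> Omega k; \<And>ms. length ms = k \<Longrightarrow> set ms \<subseteq> {..B} \<Longrightarrow> a ms = b ms\<rbrakk> \<Longrightarrow> f a = f b"
  shows "general_algorithm (Xi_problem R k \<M>) f"
proof -
  define F where "F = {ms. set ms \<subseteq> {..B} \<and> length ms = k}"
  define E where "E = (\<lambda>ms (a :: array). of_nat (a ms) :: complex) ` F"
  have "finite F"
    unfolding F_def by (rule finite_lists_length_eq) simp
  have "replicate k 0 \<in> F"
    by (auto simp: F_def)
  then have "E \<noteq> {}" "finite E"
    using \<open>finite F\<close> by (auto simp: E_def)
  moreover have "E \<subseteq> evaluations (Xi_problem R k \<M>)"
    by (auto simp: E_def F_def evaluations_def Xi_problem_def)
  moreover have "f b = f a" if ab: "a \<in> Omega k" "b \<in> Omega k" "\<forall>h\<in>E. h b = h a" for a b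
  proof (rule assms(2)[OF ab(2,1)])
    fix ms :: "nat list" assume "length ms = k" "set ms \<subseteq> {..B}"
    then have "(\<lambda>a. of_nat (a ms)) \<in> E"
      unfolding E_def F_def by blast
    with ab(3) have "(of_nat (b ms) :: complex) = of_nat (a ms)"
      by (rule bspec)
    then show "b ms = a ms" by simp
  qed
  moreover have "f \<in> Omega k \<rightarrow> mspace \<M>"
    using assms(1) by blast
  moreover have "dom_set (Xi_problem R k \<M>) = Omega k" "target (Xi_problem R k \<M>) = \<M>"
    by (simp_all add: Xi_problem_def)
  ultimately show ?thesis
    unfolding general_algorithm_def by (intro conjI exI[of _ "\<lambda>_. E"]) metis+
qed

text \<open>
  What \<open>P\<close> and \<open>Q\<close> have in common: it suffices to approximate the relation by a search \<open>C\<close> with three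
  indices that converges in each of them, reads finitely many entries, and is performed by the
  innermost levels of a search machine.
\<close>

lemma Xi_problem_Delta_A_if_search:
  assumes \<M>: "\<M> = two_point_space \<or> \<M> = unit_interval_space" and "k \<ge> 2"
    and R: "\<And>a ms. C a [] ms \<longleftrightarrow> R a ms = 1"
    and converges: "\<And>a ns ms. length ns \<le> 2 \<Longrightarrow> \<forall>\<^sub>F n in sequentially. C a (ns @ [n]) ms = C a ns ms"
    and finite_use: "\<And>a b ns ms B. \<lbrakk>length ns = 3; set ns \<subseteq> {..B}; length ms + 2 = k; set ms \<subseteq> {..B};
      \<And>ms'. length ms' = k \<Longrightarrow> set ms' \<subseteq> {..2 * B} \<Longrightarrow> a ms' = b ms'\<rbrakk> \<Longrightarrow> C a ns ms = C b ns ms"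
    and levels: "distinct (map fst ls)" "\<And>l. l \<in> set ls \<Longrightarrow> odd (fst l) \<and> 2 * k < fst l \<and> fst l < 7 + 2 * k"
    and groups: "length gs = 2" "\<And>t. t \<in> \<Union>(set ` set gs) \<Longrightarrow> 5 \<le> t \<and> t < 7 + 2 * k"
    and searches: "\<And>a ns \<rho>. \<lbrakk>length ns = k + 1; \<And>t. even t \<Longrightarrow> \<rho> t = bound ns t\<rbrakk> \<Longrightarrow>
      search ls (bound ns) (\<lambda>\<rho>. a (map (\<lambda>i. \<rho> (5 + 2 * i)) [0..<k - 2] @ map (\<lambda>g. \<Sum>t\<leftarrow>g. \<rho> t) gs) = 1) \<rho> \<longleftrightarrow>
      C a (drop (k - 2) ns) (map (\<lambda>i. \<rho> (5 + 2 * i)) [0..<k - 2])"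
  shows "Xi_problem R k \<M> \<in> Delta_A (k + 2)"
proof -
  let ?p = "Xi_problem R k \<M>"
  define \<Gamma> :: "nat list \<Rightarrow> array \<Rightarrow> real" where "\<Gamma> ns a = of_bool (bounded_prefix (k - 2) ns (C a))" for ns a
  have dom: "dom_set ?p = Omega k" and target: "target ?p = \<M>" and map: "prob_map ?p = Xi R k"
    by (simp_all add: Xi_problem_def)
  have range: "\<Gamma> ns a \<in> mspace \<M>" for ns a
    using \<M> by (auto simp: mspace_two_point_space mspace_unit_interval_space \<Gamma>_def)
  have limits: "limitin (mtopology_of \<M>) (\<lambda>n. \<Gamma> (ns @ [n]) a) (\<Gamma> ns a) sequentially"
    if "length ns < k + 1" for ns a
    unfolding \<Gamma>_def using that \<open>k \<ge> 2\<close>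
    by (intro limitin_of_bool[OF \<M>] bounded_prefix_converges converges) auto
  have Xi: "\<Gamma> [] = Xi R k"
  proof -
    have "C a [] = (\<lambda>ms. R a ms = 1)" for a
      using R by blast
    then show ?thesis
      by (intro ext) (simp only: \<Gamma>_def Xi_def bounded_prefix_Nil)
  qed
  have algorithm: "general_algorithm ?p (\<Gamma> ns)" if ns: "length ns = k + 1" for ns
  \<comment> \<open>Indices are sums of at most two of the bounds, each of which is at most \<open>sum_list ns\<close>.\<close>
  proof (rule general_algorithm_fixed_queries[where B = "2 * sum_list ns"])
    fix a b :: array
    assume ab: "\<And>ms. length ms = k \<Longrightarrow> set ms \<subseteq> {..2 * sum_list ns} \<Longrightarrow> a ms = b ms"
    have ns_bound: "set ns \<subseteq> {..sum_list ns}"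
      using member_le_sum_list by auto
    have "bounded_prefix (k - 2) ns (C a) = bounded_prefix (k - 2) ns (C b)"
    proof (rule bounded_prefix_cong[OF _ _ ns_bound])
      fix ms :: "nat list" assume ms: "length ms = k - 2" "set ms \<subseteq> {..sum_list ns}"
      show "C a (drop (k - 2) ns) ms = C b (drop (k - 2) ns) ms"
      proof (rule finite_use[OF _ _ _ ms(2)])
        show "set (drop (k - 2) ns) \<subseteq> {..sum_list ns}"
          using ns_bound set_drop_subset[of "k - 2" ns] by blast
      qed (use ms ns \<open>k \<ge> 2\<close> ab in auto)
    qed (use ns in auto)
    then show "\<Gamma> ns a = \<Gamma> ns b"
      by (simp add: \<Gamma>_def)
  qed (rule range)
  have "tower ?p (k + 1) \<Gamma>"
    unfolding tower_def dom target map
    using range algorithm limits[of "[]"] limits by (auto simp: Xi)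
  moreover
  define levels where "levels = map (\<lambda>j. (5 + 2 * j, even (k - 2 - j))) [0..<k - 2] @ ls"
  define groups where "groups = map (\<lambda>j. [5 + 2 * j]) [0..<k - 2] @ gs"
  have "\<exists>M. wf_machine M \<and> (\<forall>orc ns \<phi>. length ns = k + 1 \<longrightarrow>
     (\<forall>\<rho>. orc (map (\<lambda>g. \<Sum>t\<leftarrow>g. \<rho> t) groups) (of_bool (\<phi> \<rho>))) \<longrightarrow>
     computes M orc ns (of_bool (search levels (bound ns) \<phi> (initial_counters ns))))"
  proof (rule search_machine)
    have "inj_on (\<lambda>j. 5 + 2 * j :: nat) {0..<k - 2}" by (auto simp: inj_on_def)
    moreover have "5 + 2 * j \<noteq> fst l" if "l \<in> set ls" "j < k - 2" for j l
      using assms(7)[OF that(1)] that(2) by auto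
    ultimately show "distinct (map fst levels)"
      using assms(6) by (force simp: levels_def distinct_map comp_def)
    show "odd (fst l) \<and> 5 \<le> fst l \<and> fst l < 5 + 2 * (k + 1)" if "l \<in> set levels" for l
      using that assms(7)[of l] \<open>k \<ge> 2\<close> by (auto simp: levels_def)
    show "5 \<le> t \<and> t < 5 + 2 * (k + 1)" if "t \<in> \<Union>(set ` set groups)" for t
      using that assms(9)[of t] by (auto simp: groups_def)
  qed
  then obtain M where M: "wf_machine M"
    "\<And>orc ns \<phi>. \<lbrakk>length ns = k + 1; \<And>\<rho>. orc (map (\<lambda>g. \<Sum>t\<leftarrow>g. \<rho> t) groups) (of_bool (\<phi> \<rho>))\<rbrakk> \<Longrightarrow>
     computes M orc ns (of_bool (search levels (bound ns) \<phi> (initial_counters ns)))"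
    by blast
  have "computes M (oracle_of ?p a) ns (of_bool (bounded_prefix (k - 2) ns (C a)))"
    if a: "a \<in> Omega k" and ns: "length ns = k + 1" for a ns
  proof -
    define name where "name \<rho> = map (\<lambda>g. \<Sum>t\<leftarrow>g. \<rho> t) groups" for \<rho> :: "nat \<Rightarrow> nat"
    have name: "name \<rho> = map (\<lambda>i. \<rho> (5 + 2 * i)) [0..<k - 2] @ map (\<lambda>g. \<Sum>t\<leftarrow>g. \<rho> t) gs" for \<rho>
      by (simp add: name_def groups_def)
    have "oracle_of ?p a (name \<rho>) (of_bool (a (name \<rho>) = 1))" for \<rho>
    proof -
      have "length (name \<rho>) = k"
        using assms(8) \<open>k \<ge> 2\<close> by (simp add: name)
      moreover from this have "a (name \<rho>) \<in> {0, 1}"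
        using a by (auto simp: Omega_def)
      ultimately show ?thesis
        by (auto simp: oracle_of_def Xi_problem_def)
    qed
    then have "computes M (oracle_of ?p a) ns
        (of_bool (search levels (bound ns) (\<lambda>\<rho>. a (name \<rho>) = 1) (initial_counters ns)))"
      by (intro M(2)[OF ns]) (simp add: name_def)
    moreover have "search levels (bound ns) (\<lambda>\<rho>. a (name \<rho>) = 1) (initial_counters ns) =
        bounded_prefix (k - 2) ns (C a)"
    proof -
      have "search levels (bound ns) (\<lambda>\<rho>. a (name \<rho>) = 1) (initial_counters ns) =
        bounded_prefix (k - 2 - 0) (drop 0 ns)
          (\<lambda>ns' ms. C a ns' (map (\<lambda>i. initial_counters ns (5 + 2 * i)) [0..<0] @ ms))"
        unfolding levels_def
      proof (rule search_bounded_prefix)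
        show "search ls (bound ns) (\<lambda>\<rho>. a (name \<rho>) = 1) \<rho> =
            C a (drop (k - 2) ns) (map (\<lambda>i. \<rho> (5 + 2 * i)) [0..<k - 2])"
          if "\<And>t. even t \<Longrightarrow> \<rho> t = bound ns t" for \<rho>
          unfolding name by (rule searches[OF ns that])
      qed (use ns in \<open>auto simp: initial_counters_def\<close>)
      then show ?thesis by simp
    qed
    ultimately show ?thesis by simp
  qed
  then have "\<exists>M. wf_machine M \<and> (\<forall>a\<in>dom_set ?p. \<forall>ns. length ns = k + 1 \<longrightarrow>
      (\<exists>r. computes M (oracle_of ?p a) ns r \<and> \<Gamma> ns a = of_rat r))"
    using M(1) unfolding dom \<Gamma>_def
    by (intro exI[of _ M]) (metis of_bool_eq(1) of_bool_eq(2) of_rat_0 of_rat_1)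
  ultimately have "arithmetic_tower ?p (k + 1) \<Gamma>"
    by (simp add: arithmetic_tower_def)
  then show ?thesis
    using computational_Xi_problem[OF \<M>] by (auto simp: Delta_A_def intro!: exI[of _ "k + 1"])
qed

theorem Xi_problem_Delta_A:
  assumes \<M>: "\<M> = two_point_space \<or> \<M> = unit_interval_space" and "k \<ge> 2"
    and R: "R = P_rel \<or> R = Q_rel"
  shows "Xi_problem R k \<M> \<in> Delta_A (k + 2)"
  using R
proof
  obtain l where k: "k = l + 2"
    using \<open>k \<ge> 2\<close> by (metis add.commute le_Suc_ex)
  have drop3: "drop l ns = [ns ! l, ns ! (l + 1), ns ! (l + 2)]" if "length ns = k + 1" for ns :: "nat list"
    using that k by (simp add: Cons_nth_drop_Suc[symmetric])
  have k2: "k - 2 = l"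
    using k by simp
  {
    assume R: "R = P_rel"
    show ?thesis
    proof (rule Xi_problem_Delta_A_if_search[OF \<M> \<open>k \<ge> 2\<close>, where C = P_search
          and ls = "[(5 + 2 * l, True), (5 + 2 * (l + 2), True)]"
          and gs = "[[6 + 2 * (l + 1), 5 + 2 * (l + 2)], [5 + 2 * l]]"])
      show "P_search a [] ms \<longleftrightarrow> R a ms = 1" for a ms
        by (simp add: R P_search_def column_search_def P_rel_def INFM_nat)
      show "P_search a ns ms = P_search b ns ms"
        if "length ns = 3" "set ns \<subseteq> {..B}" "length ms + 2 = k" "set ms \<subseteq> {..B}"
          "\<And>ms'. length ms' = k \<Longrightarrow> set ms' \<subseteq> {..2 * B} \<Longrightarrow> a ms' = b ms'" for a b ns ms B
        by (rule P_search_cong[OF that])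
      fix a ns and \<rho> :: "nat \<Rightarrow> nat"
      assume ns: "length ns = k + 1" and \<rho>: "\<And>t. even t \<Longrightarrow> \<rho> t = bound ns t"
      show "search [(5 + 2 * l, True), (5 + 2 * (l + 2), True)] (bound ns)
          (\<lambda>\<rho>. a (map (\<lambda>i. \<rho> (5 + 2 * i)) [0..<k - 2] @
             map (\<lambda>g. \<Sum>t\<leftarrow>g. \<rho> t) [[6 + 2 * (l + 1), 5 + 2 * (l + 2)], [5 + 2 * l]]) = 1) \<rho> \<longleftrightarrow>
        P_search a (drop (k - 2) ns) (map (\<lambda>i. \<rho> (5 + 2 * i)) [0..<k - 2])"
        unfolding k2 drop3[OF ns] using k ns
        by (intro search_P_levels) (auto simp: bound_def \<rho>)
    qed (use k in \<open>auto intro: P_search_converges\<close>)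
  next
    assume R: "R = Q_rel"
    show ?thesis
    proof (rule Xi_problem_Delta_A_if_search[OF \<M> \<open>k \<ge> 2\<close>, where C = Q_search
          and ls = "[(5 + 2 * (l + 1), False), (5 + 2 * (l + 2), True)]"
          and gs = "[[6 + 2 * (l + 1), 5 + 2 * (l + 2)], [6 + 2 * l, 5 + 2 * (l + 1)]]"])
      show "Q_search a [] ms \<longleftrightarrow> R a ms = 1" for a ms
      proof -
        have "column_search a [] ms = (\<lambda>i. \<forall>j. \<exists>n>j. a (ms @ [n, i]) = 1)"
          by (simp add: column_search_def INFM_nat fun_eq_iff)
        then show ?thesis
          by (simp add: R Q_search_def Q_rel_def)
      qed
      show "Q_search a ns ms = Q_search b ns ms"
        if "length ns = 3" "set ns \<subseteq> {..B}" "length ms + 2 = k" "set ms \<subseteq> {..B}"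
          "\<And>ms'. length ms' = k \<Longrightarrow> set ms' \<subseteq> {..2 * B} \<Longrightarrow> a ms' = b ms'" for a b ns ms B
        by (rule Q_search_cong[OF that])
      fix a ns and \<rho> :: "nat \<Rightarrow> nat"
      assume ns: "length ns = k + 1" and \<rho>: "\<And>t. even t \<Longrightarrow> \<rho> t = bound ns t"
      show "search [(5 + 2 * (l + 1), False), (5 + 2 * (l + 2), True)] (bound ns)
          (\<lambda>\<rho>. a (map (\<lambda>i. \<rho> (5 + 2 * i)) [0..<k - 2] @
             map (\<lambda>g. \<Sum>t\<leftarrow>g. \<rho> t) [[6 + 2 * (l + 1), 5 + 2 * (l + 2)], [6 + 2 * l, 5 + 2 * (l + 1)]]) = 1) \<rho> \<longleftrightarrow>
        Q_search a (drop (k - 2) ns) (map (\<lambda>i. \<rho> (5 + 2 * i)) [0..<k - 2])"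
        unfolding k2 drop3[OF ns] using k ns
        by (intro search_Q_levels) (auto simp: bound_def \<rho>)
    qed (use k in \<open>auto intro: Q_search_converges\<close>)
  }
qed

theorem theorem5p19:
  fixes \<M> :: "real metric" and k :: nat and R :: "array \<Rightarrow> nat list \<Rightarrow> nat"
  assumes "\<M> = two_point_space \<or> \<M> = unit_interval_space"
    and "k \<ge> 2"
    and "R = P_rel \<or> R = Q_rel"
  shows "Xi_problem R k \<M> \<notin> Delta_G (k + 1) \<and> Xi_problem R k \<M> \<in> Delta_A (k + 2)"
  using Xi_problem_not_Delta_G[OF assms] Xi_problem_Delta_A[OF assms] by blast

end
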